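(* Let $(V,h)$ be a Euclidean vector space of dimension at least $4$. Then the algebra $(\mathcal{MC}_W(V^* ),\ast)$ of curvature tensors of Weyl type is exact and Killing metrized. Moreover: (1) The Killing form $\tau_\ast(X,Y)=\operatorname{tr}(L_\ast(X)L_\ast(Y))$, where $L_\ast(X)\in\operatorname{End}(\mathcal{MC}_W(V^* ))$, is a nonzero multiple of $\langle\cdot,\cdot\rangle$. (2) If $\dim V>4$, then $(\mathcal{MC}_W(V^* ),\ast)$ is simple.
   Context: All vector spaces are finite-dimensional over $\mathbb{R}$. A Euclidean vector space $(V,h)$ is one with a positive definite symmetric bilinear form $h_{ij}$; indices are raised and lowered with $h$. Square brackets (parentheses) around indices denote complete antisymmetrization (symmetrization), normalized to be projections. $\mathcal{MC}(V^* )=\{Y_{ijkl}\in\otimes^4V^*: Y_{[ij]kl}=Y_{ijkl}=Y_{ij[kl]},\ Y_{[ijk]l}=0\}$ is the space of metric curvature tensors. The Ricci trace is $\rho(Y)_{ij}=Y_{pij}{}^{p}$, and $\mathcal{MC}_W(V^* )=\ker\rho\subset\mathcal{MC}(V^* )$. The inner product is $\langle X,Y\rangle=X_{ijkl}Y^{ijkl}$. For $X\in\mathcal{MC}(V^* )$ and $k\ge2$, $\widehat X\in\operatorname{End}(\otimes^kV^* )$ is defined by $$\widehat X(\alpha)_{i_1\dots i_k}=\tfrac1k\sum_{r\ne s}X^{p}{}_{i_ri_s}{}^{q}\,\alpha_{i_1\dots p\dots q\dots i_k},$$ the sum running over ordered pairs $(r,s)$ of distinct elements of $\{1,\dots,k\}$,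 with $p$ in position $r$ and $q$ in position $s$ of $\alpha$. It preserves $\mathcal{MC}(V^* )\subset\otimes^4V^*$, and the multiplication $X\ast Y:=\widehat X(Y)$ on $\mathcal{MC}(V^* )$ is commutative and restricts to a multiplication on $\mathcal{MC}_W(V^* )$. For a commutative (not necessarily associative) algebra $(A,\circ)$, $L_\circ(x)y=x\circ y$. It is exact if $\operatorname{tr}L_\circ(x)=0$ for all $x\in A$. It is Killing metrized if the form $\tau_\circ(x,y)=\operatorname{tr}(L_\circ(x)L_\circ(y))$ is nondegenerate and invariant, i.e. $\tau_\circ(x\circ y,z)=\tau_\circ(x,y\circ z)$ for all $x,y,z$. It is simple if its multiplication is not identically zero and it has no ideals other than $\{0\}$ and $A$. *)

theory Defs
  imports "HOL-Analysis.Analysis" "HOL-Library.Function_Algebras"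
begin

section \<open>Pointwise vector space structure on functions\<close>

text \<open>Addition on functions comes from \<^theory>\<open>HOL-Library.Function_Algebras\<close>.\<close>

instantiation "fun" :: (type, real_vector) real_vector
begin

definition scaleR_fun :: "real \<Rightarrow> ('a \<Rightarrow> 'b) \<Rightarrow> 'a \<Rightarrow> 'b"
  where "scaleR_fun c f = (\<lambda>x. c *\<^sub>R f x)"

instance
  by standard (auto simp: scaleR_fun_def fun_eq_iff scaleR_add_right scaleR_add_left)

end


section \<open>Algebras\<close>

text \<open>An algebra is a finite-dimensional subspace \<open>A\<close> of an ambient real vector space with a
  multiplication \<open>m\<close> that only matters on \<open>A\<close>; \<open>m x\<close> is the operator \<open>L(x)\<close>.\<close>

definition comm_algebra :: "'v::real_vector set \<Rightarrow> ('v \<Rightarrow> 'v \<Rightarrow> 'v) \<Rightarrow> bool"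
  where "comm_algebra A m \<longleftrightarrow>
    subspace A \<and> (\<exists>B. finite B \<and> span B = A) \<and>
    (\<forall>x\<in>A. \<forall>y\<in>A. m x y \<in> A) \<and>
    (\<forall>x\<in>A. \<forall>y\<in>A. m x y = m y x) \<and>
    (\<forall>x\<in>A. \<forall>y\<in>A. \<forall>z\<in>A. m x (y + z) = m x y + m x z) \<and>
    (\<forall>x\<in>A. \<forall>y\<in>A. \<forall>c. m x (c *\<^sub>R y) = c *\<^sub>R m x y)"

text \<open>Trace of an endomorphism \<open>f\<close> of a finite-dimensional subspace \<open>S\<close>: the sum of the diagonal
  coefficients in an arbitrarily chosen basis of \<open>S\<close>.\<close>

definition trace_on :: "'v::real_vector set \<Rightarrow> ('v \<Rightarrow> 'v) \<Rightarrow> real"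
  where "trace_on S f =
    (let B = (SOME B. independent B \<and> span B = S) in \<Sum>b\<in>B. representation B (f b) b)"

definition exact_algebra :: "'v::real_vector set \<Rightarrow> ('v \<Rightarrow> 'v \<Rightarrow> 'v) \<Rightarrow> bool"
  where "exact_algebra A m \<longleftrightarrow> (\<forall>x\<in>A. trace_on A (m x) = 0)"

definition killing_form :: "'v::real_vector set \<Rightarrow> ('v \<Rightarrow> 'v \<Rightarrow> 'v) \<Rightarrow> 'v \<Rightarrow> 'v \<Rightarrow> real"
  where "killing_form A m x y = trace_on A (m x \<circ> m y)"

definition killing_metrized :: "'v::real_vector set \<Rightarrow> ('v \<Rightarrow> 'v \<Rightarrow> 'v) \<Rightarrow> bool"
  where "killing_metrized A m \<longleftrightarrow>
    (\<forall>x\<in>A. (\<forall>y\<in>A. killing_form A m x y = 0) \<longrightarrow> x = 0) \<and>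
    (\<forall>x\<in>A. \<forall>y\<in>A. \<forall>z\<in>A. killing_form A m (m x y) z = killing_form A m x (m y z))"

text \<open>Two-sided ideals, as the multiplication is commutative.\<close>

definition algebra_ideal :: "'v::real_vector set \<Rightarrow> 'v set \<Rightarrow> ('v \<Rightarrow> 'v \<Rightarrow> 'v) \<Rightarrow> bool"
  where "algebra_ideal I A m \<longleftrightarrow> subspace I \<and> I \<subseteq> A \<and> (\<forall>x\<in>A. \<forall>y\<in>I. m x y \<in> I)"

definition simple_algebra :: "'v::real_vector set \<Rightarrow> ('v \<Rightarrow> 'v \<Rightarrow> 'v) \<Rightarrow> bool"
  where "simple_algebra A m \<longleftrightarrow>
    (\<exists>x\<in>A. \<exists>y\<in>A. m x y \<noteq> 0) \<and>
    (\<forall>I. algebra_ideal I A m \<longrightarrow> I = {0} \<or> I = A)"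


section \<open>Metric curvature tensors\<close>

text \<open>The Euclidean vector space \<open>(V, h)\<close> is a type \<open>'a\<close> of class \<^class>\<open>euclidean_space\<close> with its
  inner product. An element of the \<open>k\<close>-th tensor power of \<open>V*\<close> is a \<open>k\<close>-linear form on \<open>V\<close>, taking its
  arguments as a list of length \<open>k\<close>; it is required to vanish on lists of any other length, so that
  equal forms are equal functions.\<close>

definition tensors :: "nat \<Rightarrow> ('a::euclidean_space list \<Rightarrow> real) set"
  where "tensors k = {\<alpha>.
    (\<forall>v. length v \<noteq> k \<longrightarrow> \<alpha> v = 0) \<and>
    (\<forall>v i. length v = k \<longrightarrow> i < k \<longrightarrow> linear (\<lambda>x. \<alpha> (v[i := x])))}"

text \<open>The conditions are \<open>Y\<^bsub>[ij]kl\<^esub> = Y\<^bsub>ijkl\<^esub> = Y\<^bsub>ij[kl]\<^esub>\<close> and \<open>Y\<^bsub>[ijk]l\<^esub> = 0\<close>, with the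
  antisymmetrizations written out.\<close>

definition MC :: "('a::euclidean_space list \<Rightarrow> real) set"
  where "MC = {Y \<in> tensors 4. \<forall>a b c d.
    (Y [a,b,c,d] - Y [b,a,c,d]) / 2 = Y [a,b,c,d] \<and>
    Y [a,b,c,d] = (Y [a,b,c,d] - Y [a,b,d,c]) / 2 \<and>
    (Y [a,b,c,d] + Y [b,c,a,d] + Y [c,a,b,d]
      - Y [b,a,c,d] - Y [a,c,b,d] - Y [c,b,a,d]) / 6 = 0}"

text \<open>\<^const>\<open>Basis\<close> is orthonormal, so a contraction with the metric is a sum over
  \<^const>\<open>Basis\<close> with the basis vector inserted in both contracted slots.\<close>

definition ricci :: "('a::euclidean_space list \<Rightarrow> real) \<Rightarrow> 'a \<Rightarrow> 'a \<Rightarrow> real"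
  where "ricci Y a b = (\<Sum>p\<in>Basis. Y [p,a,b,p])"

definition MC_W :: "('a::euclidean_space list \<Rightarrow> real) set"
  where "MC_W = {Y \<in> MC. \<forall>a b. ricci Y a b = 0}"

definition tensor_inner ::
    "('a::euclidean_space list \<Rightarrow> real) \<Rightarrow> ('a list \<Rightarrow> real) \<Rightarrow> real"
  where "tensor_inner X Y =
    (\<Sum>i\<in>Basis. \<Sum>j\<in>Basis. \<Sum>k\<in>Basis. \<Sum>l\<in>Basis. X [i,j,k,l] * Y [i,j,k,l])"

text \<open>The operator \<open>\<alpha> \<mapsto> X\<close>-hat \<open>(\<alpha>)\<close> on tensors of rank \<open>k\<close>; slots are numbered from 0.\<close>

definition curv_hat ::
    "nat \<Rightarrow> ('a::euclidean_space list \<Rightarrow> real) \<Rightarrow> ('a list \<Rightarrow> real) \<Rightarrow> 'a list \<Rightarrow> real"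
  where "curv_hat k X \<alpha> = (\<lambda>v. 1 / real k *
    (\<Sum>r<k. \<Sum>s\<in>{..<k} - {r}. \<Sum>p\<in>Basis. \<Sum>q\<in>Basis.
      X [p, v ! r, v ! s, q] * \<alpha> (v[r := p, s := q])))"

definition curv_mult ::
    "('a::euclidean_space list \<Rightarrow> real) \<Rightarrow> ('a list \<Rightarrow> real) \<Rightarrow> 'a list \<Rightarrow> real"
  where "curv_mult X Y = curv_hat 4 X Y"

end

theory Submission
  imports Defs
begin

text \<open>
  Write \<open>W\<close> for the space of Weyl curvature tensors and \<open>\<tau>\<close> for the trace form. The infinitesimal
  rotations \<open>D\<close> of \<open>V\<close> and the reflections in coordinate hyperplanes act on \<open>W\<close> by derivations and
  automorphisms, and both preserve the inner product. Hence \<open>\<tau>(X,Y) = \<langle>TX,Y\<rangle>\<close> with \<open>T\<close> commuting with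
  these actions, and \<open>tr L(DX) = tr [D, L(X)] = 0\<close>.

  For distinct basis vectors \<open>a, b, c, d\<close> let \<open>G\<close> be the Weyl tensor representing the functional
  \<open>Y \<mapsto> 8 (Y(a,c,b,d) + Y(a,d,b,c))\<close>. A Weyl tensor orthogonal to everything obtained from \<open>G\<close> by
  infinitesimal rotations vanishes, so these tensors span \<open>W\<close>. Moreover \<open>G\<close> is determined up to a
  factor by its weights under the rotations in the planes \<open>ab\<close> and \<open>cd\<close> together with its signs under
  the four reflections; if there is a fifth basis vector \<open>e\<close>, the weights in the planes of \<open>e\<close> and one
  of \<open>a, b, c, d\<close> replace the reflections. So an operator commuting with the actions is a scalar; in
  dimension at least five commuting with rotations suffices.

  This makes \<open>T\<close> a scalar, which is not zero because \<open>\<tau>(G,G)\<close> is the sum of the \<open>|G * w|\<^sup>2\<close> over an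
  orthonormal basis and \<open>G * G \<noteq> 0\<close>. An ideal \<open>I\<close> annihilates its orthogonal complement \<open>J\<close>, so
  \<open>\<tau>(DX,Y) = tr (D L(X) L(Y)) - tr (D L(Y) L(X))\<close> is zero for \<open>X\<close> in \<open>I\<close> and \<open>Y\<close> in \<open>J\<close>. Thus \<open>I\<close> is
  invariant under rotations, the projection to \<open>I\<close> is a scalar in dimension at least five, and \<open>I\<close>
  is trivial.
\<close>

section \<open>Evaluation of pointwise sums and multiples\<close>

lemma scaleR_fun_apply: "(c *\<^sub>R f) x = c *\<^sub>R f x"
  by (simp add: scaleR_fun_def)

lemma sum_fun_apply: "(\<Sum>i\<in>I. f i) x = (\<Sum>i\<in>I. f i x)"
  by (induction I rule: infinite_finite_induct) (auto simp: zero_fun_def plus_fun_def)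

lemmas fun_vec_simps = scaleR_fun_apply plus_fun_apply zero_fun_apply sum_fun_apply
  minus_apply uminus_apply

section \<open>Orthonormal bases and traces\<close>

lemma linear_combination:
  "linear f \<Longrightarrow> f (\<Sum>i\<in>I. c i *\<^sub>R x i) = (\<Sum>i\<in>I. c i *\<^sub>R f (x i))"
  by (simp add: linear_sum linear_scale)

text \<open>Only bilinearity and symmetry are recorded: \<open>tensor_inner\<close> is defined on
  all functions of lists but is definite just on \<open>tensors 4\<close>, so positivity is assumed
  separately on the span at hand.\<close>

definition inner_product :: "('v::real_vector \<Rightarrow> 'v \<Rightarrow> real) \<Rightarrow> bool"
  where "inner_product ip \<longleftrightarrow> (\<forall>x. linear (ip x)) \<and> (\<forall>x y. ip x y = ip y x)"

definition orthonormal_basis ::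
    "('v::real_vector \<Rightarrow> 'v \<Rightarrow> real) \<Rightarrow> 'v set \<Rightarrow> 'v set \<Rightarrow> bool"
  where "orthonormal_basis ip S E \<longleftrightarrow> finite E \<and> E \<subseteq> S \<and>
    (\<forall>d\<in>E. \<forall>e\<in>E. ip d e = (if d = e then 1 else 0)) \<and>
    (\<forall>x\<in>S. x = (\<Sum>e\<in>E. ip x e *\<^sub>R e))"

context
  fixes ip :: "'v::real_vector \<Rightarrow> 'v \<Rightarrow> real"
  assumes ip: "inner_product ip"
begin

lemma ip_linear: "linear (ip x)" and ip_commute: "ip x y = ip y x"
  using ip by (auto simp: inner_product_def)

lemma ip_linear_left: "linear (\<lambda>x. ip x y)"
  using ip_linear[of y] by (subst (asm) ip_commute[abs_def]) simp

lemma ip_sum_left: "ip (\<Sum>i\<in>I. c i *\<^sub>R f i) y = (\<Sum>i\<in>I. c i * ip (f i) y)"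
  by (simp add: linear_sum[OF ip_linear_left] linear_scale[OF ip_linear_left])

lemma ip_sum_right: "ip y (\<Sum>i\<in>I. c i *\<^sub>R f i) = (\<Sum>i\<in>I. c i * ip y (f i))"
  by (simp add: linear_sum[OF ip_linear] linear_scale[OF ip_linear])

text \<open>Gram-Schmidt, one spanning vector at a time.\<close>

lemma orthonormal_basis_span_exists:
  assumes "finite B" and "\<And>x. x \<in> span B \<Longrightarrow> x \<noteq> 0 \<Longrightarrow> ip x x > 0"
  shows "\<exists>E. orthonormal_basis ip (span B) E"
  using assms
proof (induction B rule: finite_induct)
  case empty
  show ?case
    by (rule exI[of _ "{}"]) (simp add: orthonormal_basis_def)
next
  case (insert b B)
  have sub: "span B \<subseteq> span (insert b B)"
    by (rule span_mono) auto
  obtain E where E: "orthonormal_basis ip (span B) E"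
    using insert sub by blast
  have E': "finite E" "E \<subseteq> span B" "\<And>d e. d \<in> E \<Longrightarrow> e \<in> E \<Longrightarrow> ip d e = (if d = e then 1 else 0)"
    "\<And>x. x \<in> span B \<Longrightarrow> (\<Sum>e\<in>E. ip x e *\<^sub>R e) = x"
    using E by (auto simp: orthonormal_basis_def)
  \<comment> \<open>The component of \<open>b\<close> orthogonal to \<open>span B\<close>. If it is
    zero the old basis still works, otherwise its normalization \<open>u\<close> is added.\<close>
  define c where "c = b - (\<Sum>e\<in>E. ip b e *\<^sub>R e)"
  have pr: "(\<Sum>e\<in>E. ip b e *\<^sub>R e) \<in> span B"
    using E' by (intro span_sum span_scale) auto
  have cE: "ip c e = 0" if "e \<in> E" for e
  proof -
    have "ip c e = ip b e - (\<Sum>d\<in>E. ip b d * ip d e)"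
      unfolding c_def by (simp add: linear_diff[OF ip_linear_left] ip_sum_left)
    also have "(\<Sum>d\<in>E. ip b d * ip d e) = (\<Sum>d\<in>E. if d = e then ip b d else 0)"
      by (rule sum.cong) (use that E' in auto)
    finally show ?thesis
      using that E' by simp
  qed
  have cS: "c \<in> span (insert b B)"
    unfolding c_def using pr sub span_base[of b "insert b B"] by (intro span_diff) auto
  have decomp: "\<exists>k. x - k *\<^sub>R c \<in> span B" if "x \<in> span (insert b B)" for x
  proof -
    obtain k where k: "x - k *\<^sub>R b \<in> span B"
      using \<open>x \<in> span (insert b B)\<close> by (auto simp: span_insert)
    have "x - k *\<^sub>R c = (x - k *\<^sub>R b) + k *\<^sub>R (\<Sum>e\<in>E. ip b e *\<^sub>R e)"
      by (simp add: c_def algebra_simps)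
    then show ?thesis
      using k pr by (metis span_add span_scale)
  qed
  show ?case
  proof (cases "c = 0")
    case True
    then have "span (insert b B) = span B"
      using decomp sub by fastforce
    then show ?thesis
      using E by auto
  next
    case False
    define u where "u = (1 / sqrt (ip c c)) *\<^sub>R c"
    have cc: "ip c c > 0"
      using insert.prems cS False by blast
    have uu: "ip u u = 1"
      using cc by (simp add: u_def linear_scale[OF ip_linear] linear_scale[OF ip_linear_left])
    have uE: "ip u e = 0" "ip e u = 0" if "e \<in> E" for e
      using cE[OF that] by (auto simp: u_def linear_scale[OF ip_linear_left] ip_commute[of e])
    have uS: "u \<in> span (insert b B)"
      unfolding u_def by (intro span_scale cS)
    have unE: "u \<notin> E"
      using uE uu by force
    have cu: "c = sqrt (ip c c) *\<^sub>R u"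
      using cc by (simp add: u_def)
    have "x = (\<Sum>e\<in>insert u E. ip x e *\<^sub>R e)" if x: "x \<in> span (insert b B)" for x
    proof -
      obtain k where "x - k *\<^sub>R c \<in> span B"
        using decomp[OF x] by blast
      then obtain y l where y: "y \<in> span B" and xy: "x = y + l *\<^sub>R u"
        by (metis cu diff_add_cancel add.commute scaleR_scaleR)
      have yu: "ip y u = 0"
      proof -
        have "ip y u = ip (\<Sum>e\<in>E. ip y e *\<^sub>R e) u"
          using E'(4)[OF y] by simp
        also have "\<dots> = 0"
          by (simp add: ip_sum_left uE)
        finally show ?thesis .
      qed
      have "ip x u = l"
        by (simp add: xy linear_add[OF ip_linear_left] linear_scale[OF ip_linear_left] yu uu)
      moreover have "ip x e = ip y e" if "e \<in> E" for e
        by (simp add: xy linear_add[OF ip_linear_left] linear_scale[OF ip_linear_left] uE that)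
      ultimately show ?thesis
        using E' unE y xy by simp
    qed
    then have "orthonormal_basis ip (span (insert b B)) (insert u E)"
      using E' uu uE uS sub unE by (auto simp: orthonormal_basis_def)
    then show ?thesis by blast
  qed
qed

text \<open>Independence of the basis: expanding \<open>e\<close> in the chosen basis
  \<open>B\<close> on one side and \<open>f b\<close> in \<open>E\<close> on the other turns both
  diagonal sums into the same double sum.\<close>

lemma trace_on_orthonormal_basis:
  assumes E: "orthonormal_basis ip S E" and S: "subspace S"
    and f: "linear f" "\<And>x. x \<in> S \<Longrightarrow> f x \<in> S"
  shows "trace_on S f = (\<Sum>e\<in>E. ip (f e) e)"
proof -
  have E': "finite E" "E \<subseteq> S" "\<And>x. x \<in> S \<Longrightarrow> (\<Sum>e\<in>E. ip x e *\<^sub>R e) = x"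
    using E by (auto simp: orthonormal_basis_def)
  have spanE: "S \<subseteq> span E"
  proof
    fix x assume "x \<in> S"
    have "(\<Sum>e\<in>E. ip x e *\<^sub>R e) \<in> span E"
      by (intro span_sum span_scale span_base)
    then show "x \<in> span E"
      using E'(3)[OF \<open>x \<in> S\<close>] by simp
  qed
  define B where "B = (SOME B. independent B \<and> span B = S)"
  have "\<exists>B. independent B \<and> span B = S"
    by (metis basis_exists S span_subspace)
  then have B: "independent B" "span B = S"
    unfolding B_def by (metis (mono_tags, lifting) someI_ex)+
  have "B \<subseteq> span E"
    using B spanE span_superset by blast
  then have finB: "finite B"
    using B E' independent_span_bound by blast
  have rep: "(\<Sum>b\<in>B. representation B x b *\<^sub>R b) = x" if "x \<in> S" for x
    using B finB that sum_representation_eq by blast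
  have BS: "b \<in> S" if "b \<in> B" for b
    using B that span_base by blast
  have "(\<Sum>e\<in>E. ip (f e) e) = (\<Sum>e\<in>E. \<Sum>b\<in>B. representation B e b * ip (f b) e)"
  proof (rule sum.cong[OF refl])
    fix e assume "e \<in> E"
    then have "f e = f (\<Sum>b\<in>B. representation B e b *\<^sub>R b)"
      using rep[of e] E' by auto
    also have "\<dots> = (\<Sum>b\<in>B. representation B e b *\<^sub>R f b)"
      by (rule linear_combination[OF f(1)])
    finally have "f e = (\<Sum>b\<in>B. representation B e b *\<^sub>R f b)" .
    then show "ip (f e) e = (\<Sum>b\<in>B. representation B e b * ip (f b) e)"
      by (simp add: ip_sum_left)
  qed
  also have "\<dots> = (\<Sum>b\<in>B. \<Sum>e\<in>E. ip (f b) e * representation B e b)"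
    by (subst sum.swap) (simp add: mult.commute)
  also have "\<dots> = (\<Sum>b\<in>B. representation B (f b) b)"
  proof (rule sum.cong[OF refl])
    fix b assume "b \<in> B"
    have "representation B (f b) b = representation B (\<Sum>e\<in>E. ip (f b) e *\<^sub>R e) b"
      using E'(3)[OF f(2)[OF BS[OF \<open>b \<in> B\<close>]]] by simp
    also have "\<dots> = (\<Sum>e\<in>E. representation B (ip (f b) e *\<^sub>R e) b)"
      by (subst representation_sum) (use B E' in \<open>auto intro: span_scale\<close>)
    also have "\<dots> = (\<Sum>e\<in>E. ip (f b) e * representation B e b)"
      by (rule sum.cong[OF refl], subst representation_scale) (use B E' in auto)
    finally show "(\<Sum>e\<in>E. ip (f b) e * representation B e b) = representation B (f b) b" ..
  qed
  finally show ?thesis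
    by (simp add: trace_on_def B_def Let_def)
qed

lemma trace_on_commute:
  assumes E: "orthonormal_basis ip S E" and S: "subspace S"
    and f: "linear f" "\<And>x. x \<in> S \<Longrightarrow> f x \<in> S"
    and g: "linear g" "\<And>x. x \<in> S \<Longrightarrow> g x \<in> S"
  shows "trace_on S (f \<circ> g) = trace_on S (g \<circ> f)"
proof -
  \<comment> \<open>The matrix product formula, stated for arbitrary operators because it is applied
    in both orders.\<close>
  have *: "trace_on S (f \<circ> g) = (\<Sum>e\<in>E. \<Sum>d\<in>E. ip (g e) d * ip (f d) e)"
    if f: "linear f" "\<And>x. x \<in> S \<Longrightarrow> f x \<in> S"
    and g: "linear g" "\<And>x. x \<in> S \<Longrightarrow> g x \<in> S" for f g
  proof -
    have "trace_on S (f \<circ> g) = (\<Sum>e\<in>E. ip (f (g e)) e)"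
      using trace_on_orthonormal_basis[OF E S, of "f \<circ> g"] f g by (simp add: linear_compose)
    also have "\<dots> = (\<Sum>e\<in>E. \<Sum>d\<in>E. ip (g e) d * ip (f d) e)"
    proof (rule sum.cong[OF refl])
      fix e assume "e \<in> E"
      then have "g e = (\<Sum>d\<in>E. ip (g e) d *\<^sub>R d)"
        using E g by (auto simp: orthonormal_basis_def)
      then have "f (g e) = f (\<Sum>d\<in>E. ip (g e) d *\<^sub>R d)"
        by (rule arg_cong)
      also have "\<dots> = (\<Sum>d\<in>E. ip (g e) d *\<^sub>R f d)"
        by (rule linear_combination[OF f(1)])
      finally have "f (g e) = (\<Sum>d\<in>E. ip (g e) d *\<^sub>R f d)" .
      then show "ip (f (g e)) e = (\<Sum>d\<in>E. ip (g e) d * ip (f d) e)"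
        by (simp add: ip_sum_left)
    qed
    finally show ?thesis .
  qed
  have "trace_on S (f \<circ> g) = (\<Sum>e\<in>E. \<Sum>d\<in>E. ip (g e) d * ip (f d) e)"
    by (rule *) (use f g in auto)
  also have "\<dots> = (\<Sum>e\<in>E. \<Sum>d\<in>E. ip (f e) d * ip (g d) e)"
    by (subst sum.swap) (simp add: mult.commute)
  also have "\<dots> = trace_on S (g \<circ> f)"
    by (rule *[symmetric]) (use f g in auto)
  finally show ?thesis .
qed

end

section \<open>Rank four tensors\<close>

lemma linear_mult_const:
  fixes f :: "'a::real_vector \<Rightarrow> real"
  assumes "linear f"
  shows "linear (\<lambda>x. r * f x)" "linear (\<lambda>x. f x * r)"
  using linear_compose_scale_right[OF assms, of r] by (simp_all add: mult.commute)

lemma length_4E: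
  assumes "length v = 4"
  obtains a b c d where "v = [a, b, c, d]"
  using assms by (auto simp: numeral_eq_Suc length_Suc_conv)

lemma tensors4_iff:
  "X \<in> tensors 4 \<longleftrightarrow> (\<forall>v. length v \<noteq> 4 \<longrightarrow> X v = 0) \<and>
    (\<forall>a b c d. linear (\<lambda>x. X [x, b, c, d]) \<and> linear (\<lambda>x. X [a, x, c, d]) \<and>
      linear (\<lambda>x. X [a, b, x, d]) \<and> linear (\<lambda>x. X [a, b, c, x]))" (is "_ \<longleftrightarrow> ?R")
proof
  assume X: "X \<in> tensors 4"
  have "linear (\<lambda>x. X ([a, b, c, d][i := x]))" if "i < 4" for a b c d i
    using X that by (auto simp: tensors_def simp del: list_update.simps)
  from this[of 0] this[of 1] this[of 2] this[of 3] show ?R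
    using X by (simp add: tensors_def)
next
  assume R: ?R
  have "linear (\<lambda>x. X (v[i := x]))" if v: "length v = 4" and i: "i < 4" for v i
  proof -
    obtain a b c d where "v = [a, b, c, d]"
      using length_4E[OF v] .
    moreover have "i = 0 \<or> i = 1 \<or> i = 2 \<or> i = 3"
      using i by auto
    ultimately show ?thesis
      using R by auto
  qed
  then show "X \<in> tensors 4"
    using R by (auto simp: tensors_def)
qed

lemma tensors4_linear:
  assumes "X \<in> tensors 4"
  shows "linear (\<lambda>x. X [x, b, c, d])" "linear (\<lambda>x. X [a, x, c, d])"
    "linear (\<lambda>x. X [a, b, x, d])" "linear (\<lambda>x. X [a, b, c, x])"
  using assms by (auto simp: tensors4_iff)

lemma tensors4_zero: "X \<in> tensors 4 \<Longrightarrow> length v \<noteq> 4 \<Longrightarrow> X v = 0"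
  by (simp add: tensors4_iff)

lemma tensors4_simps:
  assumes "X \<in> tensors 4"
  shows "X [x + y, b, c, d] = X [x, b, c, d] + X [y, b, c, d]"
    "X [a, x + y, c, d] = X [a, x, c, d] + X [a, y, c, d]"
    "X [a, b, x + y, d] = X [a, b, x, d] + X [a, b, y, d]"
    "X [a, b, c, x + y] = X [a, b, c, x] + X [a, b, c, y]"
    "X [- x, b, c, d] = - X [x, b, c, d]" "X [a, - x, c, d] = - X [a, x, c, d]"
    "X [a, b, - x, d] = - X [a, b, x, d]" "X [a, b, c, - x] = - X [a, b, c, x]"
    "X [0, b, c, d] = 0" "X [a, 0, c, d] = 0" "X [a, b, 0, d] = 0" "X [a, b, c, 0] = 0"
    "X [r *\<^sub>R x, b, c, d] = r * X [x, b, c, d]" "X [a, r *\<^sub>R x, c, d] = r * X [a, x, c, d]"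
    "X [a, b, r *\<^sub>R x, d] = r * X [a, b, x, d]" "X [a, b, c, r *\<^sub>R x] = r * X [a, b, c, x]"
proof -
  note L = tensors4_linear[OF assms]
  show "X [x + y, b, c, d] = X [x, b, c, d] + X [y, b, c, d]"
    "X [a, x + y, c, d] = X [a, x, c, d] + X [a, y, c, d]"
    "X [a, b, x + y, d] = X [a, b, x, d] + X [a, b, y, d]"
    "X [a, b, c, x + y] = X [a, b, c, x] + X [a, b, c, y]"
    by (rule L[THEN linear_add])+
  show "X [- x, b, c, d] = - X [x, b, c, d]" "X [a, - x, c, d] = - X [a, x, c, d]"
    "X [a, b, - x, d] = - X [a, b, x, d]" "X [a, b, c, - x] = - X [a, b, c, x]"
    by (rule L[THEN linear_neg])+
  show "X [0, b, c, d] = 0" "X [a, 0, c, d] = 0" "X [a, b, 0, d] = 0" "X [a, b, c, 0] = 0"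
    by (rule L[THEN linear_0])+
  show "X [r *\<^sub>R x, b, c, d] = r * X [x, b, c, d]" "X [a, r *\<^sub>R x, c, d] = r * X [a, x, c, d]"
    "X [a, b, r *\<^sub>R x, d] = r * X [a, b, x, d]" "X [a, b, c, r *\<^sub>R x] = r * X [a, b, c, x]"
    by (rule L[THEN linear_scale, unfolded real_scaleR_def])+
qed

lemma tensors4_ext:
  assumes "X \<in> tensors 4" "Y \<in> tensors 4"
    and "\<And>a b c d. X [a, b, c, d] = Y [a, b, c, d]"
  shows "X = Y"
proof
  fix v show "X v = Y v"
    by (cases "length v = 4") (use assms length_4E[of v] tensors4_zero in metis)+
qed

text \<open>Linearity frees one slot at a time from the basis, starting with the last.\<close>

lemma tensors4_ext_Basis:
  assumes X: "X \<in> tensors 4" and Y: "Y \<in> tensors 4"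
    and eq: "\<And>a b c d. a \<in> Basis \<Longrightarrow> b \<in> Basis \<Longrightarrow> c \<in> Basis \<Longrightarrow> d \<in> Basis \<Longrightarrow>
      X [a, b, c, d] = Y [a, b, c, d]"
  shows "X = Y"
proof (rule tensors4_ext[OF X Y])
  have 1: "X [a, b, c, d] = Y [a, b, c, d]" if "a \<in> Basis" "b \<in> Basis" "c \<in> Basis" for a b c d
  proof -
    have "(\<lambda>x. X [a, b, c, x]) = (\<lambda>x. Y [a, b, c, x])"
      by (rule linear_eq_stdbasis) (use tensors4_linear[OF X] tensors4_linear[OF Y] eq that in auto)
    then show ?thesis by (rule fun_cong)
  qed
  have 2: "X [a, b, c, d] = Y [a, b, c, d]" if "a \<in> Basis" "b \<in> Basis" for a b c d
  proof -
    have "(\<lambda>x. X [a, b, x, d]) = (\<lambda>x. Y [a, b, x, d])"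
      by (rule linear_eq_stdbasis) (use tensors4_linear[OF X] tensors4_linear[OF Y] 1 that in auto)
    then show ?thesis by (rule fun_cong)
  qed
  have 3: "X [a, b, c, d] = Y [a, b, c, d]" if "a \<in> Basis" for a b c d
  proof -
    have "(\<lambda>x. X [a, x, c, d]) = (\<lambda>x. Y [a, x, c, d])"
      by (rule linear_eq_stdbasis) (use tensors4_linear[OF X] tensors4_linear[OF Y] 2 that in auto)
    then show ?thesis by (rule fun_cong)
  qed
  show "X [a, b, c, d] = Y [a, b, c, d]" for a b c d
  proof -
    have "(\<lambda>x. X [x, b, c, d]) = (\<lambda>x. Y [x, b, c, d])"
      by (rule linear_eq_stdbasis) (use tensors4_linear[OF X] tensors4_linear[OF Y] 3 in auto)
    then show ?thesis by (rule fun_cong)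
  qed
qed

text \<open>Given antisymmetry in the first two slots, the six-term antisymmetrization is twice the
  cyclic sum.\<close>

lemma MC_iff:
  "X \<in> MC \<longleftrightarrow> X \<in> tensors 4 \<and> (\<forall>a b c d. X [b, a, c, d] = - X [a, b, c, d] \<and>
    X [a, b, d, c] = - X [a, b, c, d] \<and> X [a, b, c, d] + X [b, c, a, d] + X [c, a, b, d] = 0)"
  (is "_ \<longleftrightarrow> ?R")
proof
  assume X: "X \<in> MC"
  have m: "(X [a, b, c, d] - X [b, a, c, d]) / 2 = X [a, b, c, d]"
    "X [a, b, c, d] = (X [a, b, c, d] - X [a, b, d, c]) / 2"
    "(X [a, b, c, d] + X [b, c, a, d] + X [c, a, b, d]
      - X [b, a, c, d] - X [a, c, b, d] - X [c, b, a, d]) / 6 = 0" for a b c d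
    using X unfolding MC_def by blast+
  have 1: "X [b, a, c, d] = - X [a, b, c, d]" "X [a, b, d, c] = - X [a, b, c, d]" for a b c d
    using m(1,2)[of a b c d] by (simp_all add: field_simps)
  have m3: "X [a, b, c, d] + X [b, c, a, d] + X [c, a, b, d]
      - X [b, a, c, d] - X [a, c, b, d] - X [c, b, a, d] = 0" for a b c d
    using m(3)[of a b c d] by simp
  have "X [a, b, c, d] + X [b, c, a, d] + X [c, a, b, d] = 0" for a b c d
    using m3[of a b c d] 1(1)[of a b c d] 1(1)[of c a b d] 1(1)[of b c a d] by linarith
  moreover have "X \<in> tensors 4"
    using X by (simp add: MC_def)
  ultimately show ?R
    using 1 by blast
next
  assume R: ?R
  have 1: "X [b, a, c, d] = - X [a, b, c, d]" "X [a, b, d, c] = - X [a, b, c, d]"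
    "X [a, b, c, d] + X [b, c, a, d] + X [c, a, b, d] = 0" for a b c d
    using R by blast+
  have "X [a, b, c, d] + X [b, c, a, d] + X [c, a, b, d]
      - X [b, a, c, d] - X [a, c, b, d] - X [c, b, a, d] = 0" for a b c d
    using 1(3)[of a b c d] 1(1)[of a b c d] 1(1)[of c a b d] 1(1)[of b c a d] by linarith
  moreover have "(X [a, b, c, d] - X [b, a, c, d]) / 2 = X [a, b, c, d]" for a b c d
    using 1(1)[of a b c d] by argo
  moreover have "X [a, b, c, d] = (X [a, b, c, d] - X [a, b, d, c]) / 2" for a b c d
    using 1(2)[of a b c d] by argo
  moreover have "(X [a, b, c, d] + X [b, c, a, d] + X [c, a, b, d]
      - X [b, a, c, d] - X [a, c, b, d] - X [c, b, a, d]) / 6 = 0" for a b c d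
    using calculation(1)[of a b c d] by simp
  ultimately show "X \<in> MC"
    using R unfolding MC_def by blast
qed

lemma MC_I:
  assumes "X \<in> tensors 4" and "\<And>a b c d. X [b, a, c, d] = - X [a, b, c, d]"
    and "\<And>a b c d. X [a, b, d, c] = - X [a, b, c, d]"
    and "\<And>a b c d. X [a, b, c, d] + X [b, c, a, d] + X [c, a, b, d] = 0"
  shows "X \<in> MC"
  by (rule iffD2[OF MC_iff]) (intro conjI allI assms)

lemma MC_tensors: "X \<in> MC \<Longrightarrow> X \<in> tensors 4"
  and MC_W_MC: "X \<in> MC_W \<Longrightarrow> X \<in> MC"
  unfolding MC_def MC_W_def by blast+

lemma
  assumes X: "X \<in> MC"
  shows MC_swap12: "X [b, a, c, d] = - X [a, b, c, d]"
    and MC_swap34: "X [a, b, d, c] = - X [a, b, c, d]"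
    and MC_Bianchi: "X [a, b, c, d] + X [b, c, a, d] + X [c, a, b, d] = 0"
    and MC_pair: "X [c, d, a, b] = X [a, b, c, d]"
    and MC_rev: "X [d, c, b, a] = X [a, b, c, d]"
proof -
  note R = iffD1[OF MC_iff X, THEN conjunct2, THEN spec, THEN spec, THEN spec, THEN spec]
  show 1: "X [b, a, c, d] = - X [a, b, c, d]" for a b c d
    by (rule R[THEN conjunct1])
  show 2: "X [a, b, d, c] = - X [a, b, c, d]" for a b c d
    by (rule R[THEN conjunct2, THEN conjunct1])
  show 3: "X [a, b, c, d] + X [b, c, a, d] + X [c, a, b, d] = 0" for a b c d
    by (rule R[THEN conjunct2, THEN conjunct2])
  show pair: "X [c, d, a, b] = X [a, b, c, d]" for a b c d
  proof -
    \<comment> \<open>The Bianchi identities with \<open>d\<close>, \<open>a\<close>,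
      \<open>b\<close>, \<open>c\<close> in turn in the last slot. Adding the first two and
      subtracting the other two leaves twice the difference of the two sides.\<close>
    have "X [a, b, c, d] + X [b, c, a, d] - X [a, c, b, d] = 0"
      using 3[of a b c d] 1[of a c b d] by linarith
    moreover have "X [b, d, a, c] - X [b, c, a, d] - X [c, d, a, b] = 0"
      using 3[of b c d a] 1[of b d c a] 2[of b d a c] 2[of b c a d] 2[of c d a b]
      by linarith
    moreover have "X [c, d, a, b] + X [a, d, b, c] - X [a, c, b, d] = 0"
      using 3[of c d a b] 1[of a d c b] 2[of a d b c] 2[of a c b d] by linarith
    moreover have "X [b, d, a, c] - X [a, d, b, c] - X [a, b, c, d] = 0"
      using 3[of d a b c] 1[of a d b c] 2[of a b c d] by linarith
    ultimately show ?thesis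
      by linarith
  qed
  show "X [d, c, b, a] = X [a, b, c, d]"
    using pair[of b a d c] 1[of a b d c] 2[of a b c d] by linarith
qed

lemma subspace_MC: "subspace (MC :: ('a::euclidean_space list \<Rightarrow> real) set)"
  unfolding subspace_def
proof (intro conjI ballI allI)
  show "(0 :: 'a list \<Rightarrow> real) \<in> MC"
    by (simp add: MC_iff tensors4_iff linear_zero)
next
  fix X Y :: "'a list \<Rightarrow> real" assume XY: "X \<in> MC" "Y \<in> MC"
  have "X + Y \<in> tensors 4"
    using XY[THEN MC_tensors] by (simp add: tensors4_iff plus_fun_def linear_compose_add)
  moreover have "(X + Y) [b, a, c, d] = - (X + Y) [a, b, c, d]" for a b c d
    using MC_swap12[OF XY(1), of b a c d] MC_swap12[OF XY(2), of b a c d]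
    unfolding fun_vec_simps by linarith
  moreover have "(X + Y) [a, b, d, c] = - (X + Y) [a, b, c, d]" for a b c d
    using MC_swap34[OF XY(1), of a b d c] MC_swap34[OF XY(2), of a b d c]
    unfolding fun_vec_simps by linarith
  moreover have "(X + Y) [a, b, c, d] + (X + Y) [b, c, a, d] + (X + Y) [c, a, b, d] = 0" for a b c d
    using MC_Bianchi[OF XY(1), of a b c d] MC_Bianchi[OF XY(2), of a b c d]
    unfolding fun_vec_simps by linarith
  ultimately show "X + Y \<in> MC"
    by (rule MC_I)
next
  fix X :: "'a list \<Rightarrow> real" and r :: real assume X: "X \<in> MC"
  have "r *\<^sub>R X \<in> tensors 4"
    using MC_tensors[OF X] by (auto simp: tensors4_iff scaleR_fun_def intro: linear_mult_const)
  moreover have "(r *\<^sub>R X) [b, a, c, d] = - (r *\<^sub>R X) [a, b, c, d]" for a b c d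
    unfolding fun_vec_simps by (subst MC_swap12[OF X]) simp
  moreover have "(r *\<^sub>R X) [a, b, d, c] = - (r *\<^sub>R X) [a, b, c, d]" for a b c d
    unfolding fun_vec_simps by (subst MC_swap34[OF X]) simp
  moreover have "(r *\<^sub>R X) [a, b, c, d] + (r *\<^sub>R X) [b, c, a, d] + (r *\<^sub>R X) [c, a, b, d] = 0"
    for a b c d
    unfolding fun_vec_simps
    by (simp only: MC_Bianchi[OF X] scaleR_zero_right flip: scaleR_add_right)
  ultimately show "r *\<^sub>R X \<in> MC"
    by (rule MC_I)
qed

lemma subspace_MC_W: "subspace (MC_W :: ('a::euclidean_space list \<Rightarrow> real) set)"
  using subspace_MC
  by (auto simp: subspace_def MC_W_def ricci_def fun_vec_simps sum.distrib simp flip: sum_distrib_left)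


section \<open>The curvature product\<close>

text \<open>One summand of the operator \<open>X\<close>-hat: contraction of \<open>X\<close> with two slots of a tensor, the other
  slots being frozen in \<open>f\<close>.\<close>

definition contr ::
    "('a::euclidean_space list \<Rightarrow> real) \<Rightarrow> ('a \<Rightarrow> 'a \<Rightarrow> real) \<Rightarrow> 'a \<Rightarrow> 'a \<Rightarrow> real"
  where "contr X f i j = (\<Sum>p\<in>Basis. \<Sum>q\<in>Basis. X [p, i, j, q] * f p q)"

lemma contr_add: "contr X (\<lambda>p q. f p q + g p q) i j = contr X f i j + contr X g i j"
  and contr_minus: "contr X (\<lambda>p q. - f p q) i j = - contr X f i j"
  and contr_zero: "contr X (\<lambda>p q. 0) i j = 0"
  by (simp_all add: contr_def distrib_left sum.distrib sum_negf)

text \<open>By the reversal symmetry of \<open>X\<close>, the ordered pairs of slots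
  \<open>(r, s)\<close> and \<open>(s, r)\<close> contribute equally to the hat operator.\<close>

lemma contr_swap: "X \<in> MC \<Longrightarrow> contr X (\<lambda>p q. f q p) i j = contr X f j i"
  unfolding contr_def by (subst sum.swap) (simp add: MC_rev[of X _ j i])

lemma contr_linear:
  assumes "X \<in> tensors 4"
  shows "linear (\<lambda>i. contr X f i j)" "linear (\<lambda>j. contr X f i j)"
  unfolding contr_def
  by (intro linear_compose_sum ballI linear_mult_const tensors4_linear[OF assms])+

lemma contr_linear_fun:
  assumes "\<And>p q. linear (\<lambda>x. f x p q)"
  shows "linear (\<lambda>x. contr X (f x) i j)"
  unfolding contr_def by (intro linear_compose_sum ballI linear_mult_const assms)

lemma sum_pairs_swap:
  "(\<Sum>i\<in>A. \<Sum>j\<in>B. \<Sum>p\<in>C. \<Sum>q\<in>D. F i j p q) = (\<Sum>p\<in>C. \<Sum>q\<in>D. \<Sum>i\<in>A. \<Sum>j\<in>B. F i j p q)"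
proof -
  have "(\<Sum>i\<in>A. \<Sum>j\<in>B. \<Sum>p\<in>C. \<Sum>q\<in>D. F i j p q) = (\<Sum>i\<in>A. \<Sum>p\<in>C. \<Sum>q\<in>D. \<Sum>j\<in>B. F i j p q)"
    by (rule sum.cong[OF refl], subst sum.swap, rule sum.cong[OF refl], rule sum.swap)
  also have "\<dots> = (\<Sum>p\<in>C. \<Sum>q\<in>D. \<Sum>i\<in>A. \<Sum>j\<in>B. F i j p q)"
    by (subst sum.swap, rule sum.cong[OF refl], rule sum.swap)
  finally show ?thesis .
qed

text \<open>The kernel \<open>X [p, i, j, q]\<close> is unchanged when \<open>(p, q)\<close> is
  exchanged with \<open>(i, j)\<close>, so it is a symmetric matrix indexed by pairs.\<close>

lemma contr_self_adjoint:
  assumes X: "X \<in> MC"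
  shows "(\<Sum>i\<in>Basis. \<Sum>j\<in>Basis. contr X f i j * g i j) =
    (\<Sum>i\<in>Basis. \<Sum>j\<in>Basis. f i j * contr X g i j)"
proof -
  have sw: "X [p, i, j, q] = X [i, p, q, j]" for p i j q
    using MC_swap12[OF X, of p i j q] MC_swap34[OF X, of i p q j] by simp
  let ?F = "\<lambda>i j p q. X [p, i, j, q] * f p q * g i j"
  have "(\<Sum>i\<in>Basis. \<Sum>j\<in>Basis. contr X f i j * g i j) =
      (\<Sum>i\<in>Basis. \<Sum>j\<in>Basis. \<Sum>p\<in>Basis. \<Sum>q\<in>Basis. ?F i j p q)"
    by (simp add: contr_def sum_distrib_right)
  also have "\<dots> = (\<Sum>p\<in>Basis. \<Sum>q\<in>Basis. \<Sum>i\<in>Basis. \<Sum>j\<in>Basis. ?F i j p q)"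
    by (rule sum_pairs_swap)
  also have "\<dots> = (\<Sum>i\<in>Basis. \<Sum>j\<in>Basis. f i j * contr X g i j)"
    by (subst sw) (simp add: contr_def sum_distrib_left mult_ac)
  finally show ?thesis .
qed

text \<open>The twelve ordered pairs of slots agree two by two, so the factor 1/4 becomes 1/2 over
  the six unordered pairs.\<close>

lemma curv_mult_eq:
  assumes X: "X \<in> MC"
  shows "curv_mult X Y [i, j, k, l] = 1 / 2 *
    (contr X (\<lambda>p q. Y [p, q, k, l]) i j + contr X (\<lambda>p q. Y [p, j, q, l]) i k +
     contr X (\<lambda>p q. Y [p, j, k, q]) i l + contr X (\<lambda>p q. Y [i, p, q, l]) j k +
     contr X (\<lambda>p q. Y [i, p, k, q]) j l + contr X (\<lambda>p q. Y [i, j, p, q]) k l)"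
proof -
  have sum4: "(\<Sum>r<4. g r) = g 0 + g (Suc 0) + g (Suc (Suc 0)) + g (Suc (Suc (Suc 0)))"
    for g :: "nat \<Rightarrow> real"
    by (simp add: numeral_eq_Suc)
  have diff4: "{..<4} - {0} = {Suc 0, Suc (Suc 0), Suc (Suc (Suc 0))}"
    "{..<4} - {Suc 0} = {0, Suc (Suc 0), Suc (Suc (Suc 0))}"
    "{..<4} - {Suc (Suc 0)} = {0, Suc 0, Suc (Suc (Suc 0))}"
    "{..<4} - {Suc (Suc (Suc 0))} = {0, Suc 0, Suc (Suc 0)}"
    by auto
  have "curv_mult X Y [i, j, k, l] = 1 / 4 *
    (contr X (\<lambda>p q. Y [p, q, k, l]) i j + contr X (\<lambda>p q. Y [p, j, q, l]) i k +
     contr X (\<lambda>p q. Y [p, j, k, q]) i l + contr X (\<lambda>p q. Y [i, p, q, l]) j k +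
     contr X (\<lambda>p q. Y [i, p, k, q]) j l + contr X (\<lambda>p q. Y [i, j, p, q]) k l +
     (contr X (\<lambda>q p. Y [p, q, k, l]) j i + contr X (\<lambda>q p. Y [p, j, q, l]) k i +
     contr X (\<lambda>q p. Y [p, j, k, q]) l i + contr X (\<lambda>q p. Y [i, p, q, l]) k j +
     contr X (\<lambda>q p. Y [i, p, k, q]) l j + contr X (\<lambda>q p. Y [i, j, p, q]) l k))"
    unfolding curv_mult_def curv_hat_def sum4 diff4 contr_def by simp
  then show ?thesis
    by (simp add: contr_swap[OF X, of "\<lambda>p q. Y [p, q, k, l]"] 
      contr_swap[OF X, of "\<lambda>p q. Y [p, j, q, l]"] contr_swap[OF X, of "\<lambda>p q. Y [p, j, k, q]"]
      contr_swap[OF X, of "\<lambda>p q. Y [i, p, q, l]"] contr_swap[OF X, of "\<lambda>p q. Y [i, p, k, q]"]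
      contr_swap[OF X, of "\<lambda>p q. Y [i, j, p, q]"] field_simps)
qed

lemma curv_mult_tensors:
  assumes "X \<in> MC" "Y \<in> tensors 4"
  shows "curv_mult X Y \<in> tensors 4"
  unfolding tensors4_iff
proof (intro conjI allI impI)
  show "curv_mult X Y v = 0" if "length v \<noteq> 4" for v
    using that by (simp add: curv_mult_def curv_hat_def tensors4_zero[OF assms(2)])
qed (unfold curv_mult_eq[OF assms(1)],
    (intro linear_mult_const linear_compose_add contr_linear contr_linear_fun
      tensors4_linear[OF assms(2)] MC_tensors[OF assms(1)])+)

lemma linear_curv_mult: "linear (curv_mult X)"
  by (rule linearI) (auto simp: curv_mult_def curv_hat_def fun_vec_simps distrib_left sum.distrib
      sum_distrib_left mult_ac)

lemma linear_curv_mult_left: "linear (\<lambda>X. curv_mult X Y)"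
  by (rule linearI) (auto simp: curv_mult_def curv_hat_def fun_vec_simps distrib_left distrib_right
      sum.distrib sum_distrib_left mult_ac)

text \<open>An antisymmetric \<open>f\<close> sees only the part of the kernel antisymmetric in
  \<open>i\<close> and \<open>j\<close>, and the Bianchi identity rewrites that part as a single
  curvature component.\<close>

lemma contr_antisym:
  assumes X: "X \<in> MC" and f: "\<And>p q. f q p = - f p q"
  shows "contr X f i j = - 1 / 2 * (\<Sum>p\<in>Basis. \<Sum>q\<in>Basis. X [i, j, p, q] * f p q)"
proof -
  have 1: "X [p, i, j, q] - X [p, j, i, q] = - X [i, j, p, q]" for p q
    using MC_Bianchi[OF X, of p i j q] MC_swap12[OF X, of j p i q] by linarith
  have "contr X f j i = contr X (\<lambda>p q. f q p) i j"
    by (rule contr_swap[OF X, symmetric])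
  also have "\<dots> = - contr X f i j"
    by (subst f) (rule contr_minus)
  finally have "2 * contr X f i j = contr X f i j - contr X f j i"
    by simp
  also have "\<dots> = (\<Sum>p\<in>Basis. \<Sum>q\<in>Basis. (X [p, i, j, q] - X [p, j, i, q]) * f p q)"
    by (simp add: contr_def left_diff_distrib sum_subtractf)
  also have "\<dots> = - (\<Sum>p\<in>Basis. \<Sum>q\<in>Basis. X [i, j, p, q] * f p q)"
    by (simp add: 1 sum_negf)
  finally show ?thesis
    by simp
qed

text \<open>The summand of \<open>X * Y\<close> for a pair of slots is that of \<open>Y * X\<close> for the complementary pair.\<close>

lemma curv_mult_commute:
  assumes X: "X \<in> MC" and Y: "Y \<in> MC"
  shows "curv_mult X Y = curv_mult Y X"
proof (rule tensors4_ext)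
  show "curv_mult X Y \<in> tensors 4" "curv_mult Y X \<in> tensors 4"
    using X Y by (auto intro: curv_mult_tensors MC_tensors)
  fix i j k l
  \<comment> \<open>The pairs of slots (1,2) and (3,4) need \<open>contr_antisym\<close>; for the
    mixed pairs the sums agree term by term.\<close>
  have 1: "contr X (\<lambda>p q. Y [p, q, k, l]) i j = contr Y (\<lambda>p q. X [i, j, p, q]) k l"
    if "X \<in> MC" "Y \<in> MC" for X Y :: "'a list \<Rightarrow> real"
    by (subst contr_antisym[OF that(1)], rule MC_swap12[OF that(2)],
        subst contr_antisym[OF that(2)], rule MC_swap34[OF that(1)])
      (simp add: MC_pair[OF that(2), of k l] mult.commute)
  have 2: "contr X (\<lambda>p q. Y [p, j, q, l]) i k = contr Y (\<lambda>p q. X [i, p, k, q]) j l"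
    if "X \<in> MC" "Y \<in> MC" for X Y :: "'a list \<Rightarrow> real"
    unfolding contr_def
    by (intro sum.cong refl)
      (simp add: MC_swap12[OF that(1), of _ i] MC_swap34[OF that(2), of _ _ _ l])
  have 3: "contr X (\<lambda>p q. Y [p, j, k, q]) i l = contr Y (\<lambda>p q. X [i, p, q, l]) j k"
    if "X \<in> MC" "Y \<in> MC" for X Y :: "'a list \<Rightarrow> real"
    unfolding contr_def
    by (intro sum.cong refl)
      (simp add: MC_swap12[OF that(1), of _ i] MC_swap34[OF that(1), of _ _ _ l])
  show "curv_mult X Y [i, j, k, l] = curv_mult Y X [i, j, k, l]"
    unfolding curv_mult_eq[OF X] curv_mult_eq[OF Y]
    using 1[OF X Y] 1[OF Y X] 2[OF X Y] 2[OF Y X] 3[OF X Y] 3[OF Y X] by simp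
qed

lemma curv_mult_MC:
  assumes X: "X \<in> MC" and Y: "Y \<in> MC"
  shows "curv_mult X Y \<in> MC"
proof (rule MC_I)
  show "curv_mult X Y \<in> tensors 4"
    using X Y by (auto intro: curv_mult_tensors MC_tensors)
  \<comment> \<open>The functions \<open>c\<close> and \<open>d\<close> fill the last two slots, so
    that either of them may be the contracted one.\<close>
  have n12: "contr X (\<lambda>p q. Y [p, x, c p q, d p q]) i j = - contr X (\<lambda>p q. Y [x, p, c p q, d p q]) i j"
    for x c d i j
    by (subst MC_swap12[OF Y]) (rule contr_minus)
  have n34: "contr X (\<lambda>p q. Y [c p q, d p q, q, x]) i j = - contr X (\<lambda>p q. Y [c p q, d p q, x, q]) i j"
    for x c d i j
    by (subst MC_swap34[OF Y]) (rule contr_minus)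
  fix i j k l
  have "contr X (\<lambda>p q. Y [p, q, k, l]) j i = - contr X (\<lambda>p q. Y [p, q, k, l]) i j"
    by (subst contr_swap[OF X, symmetric], subst MC_swap12[OF Y]) (rule contr_minus)
  moreover have "contr X (\<lambda>p q. Y [j, i, p, q]) k l = - contr X (\<lambda>p q. Y [i, j, p, q]) k l"
    by (subst MC_swap12[OF Y]) (rule contr_minus)
  ultimately show "curv_mult X Y [j, i, k, l] = - curv_mult X Y [i, j, k, l]"
    using n12[of i "\<lambda>p q. q" "\<lambda>p q. l" j k] n12[of i "\<lambda>p q. k" "\<lambda>p q. q" j l]
      n12[of j "\<lambda>p q. q" "\<lambda>p q. l" i k] n12[of j "\<lambda>p q. k" "\<lambda>p q. q" i l]
    unfolding curv_mult_eq[OF X] by argo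
  have "contr X (\<lambda>p q. Y [i, j, p, q]) l k = - contr X (\<lambda>p q. Y [i, j, p, q]) k l"
    by (subst contr_swap[OF X, symmetric], subst MC_swap34[OF Y]) (rule contr_minus)
  moreover have "contr X (\<lambda>p q. Y [p, q, l, k]) i j = - contr X (\<lambda>p q. Y [p, q, k, l]) i j"
    by (subst MC_swap34[OF Y]) (rule contr_minus)
  ultimately show "curv_mult X Y [i, j, l, k] = - curv_mult X Y [i, j, k, l]"
    using n34[of "\<lambda>p q. p" "\<lambda>p q. j" l i k] n34[of "\<lambda>p q. i" "\<lambda>p q. p" l j k]
      n34[of "\<lambda>p q. p" "\<lambda>p q. j" k i l] n34[of "\<lambda>p q. i" "\<lambda>p q. p" k j l]
    unfolding curv_mult_eq[OF X] by argo
  have b: "contr X f i j + contr X g i j + contr X h i j = 0"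
    if "\<And>p q. f p q + g p q + h p q = 0" for f g h i j
    using that by (simp add: contr_zero flip: contr_add)
  \<comment> \<open>The 18 terms of the cyclic sum split into six Bianchi triples of
    \<open>Y\<close>: three with both contracted arguments among \<open>i, j, k\<close>, and three
    in which \<open>l\<close> is contracted.\<close>
  have b1: "contr X (\<lambda>p q. Y [p, q, k, l]) i j + contr X (\<lambda>p q. Y [p, k, q, l]) j i +
      contr X (\<lambda>p q. Y [k, p, q, l]) i j = 0" for i j k
    by (subst contr_swap[OF X, of "\<lambda>p q. Y [p, k, q, l]", symmetric], rule b)
      (rule MC_Bianchi[OF Y])
  have b2: "contr X (\<lambda>p q. Y [p, j, k, q]) i l + contr X (\<lambda>p q. Y [j, k, p, q]) i l +
      contr X (\<lambda>p q. Y [k, p, j, q]) i l = 0" for i j k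
    by (rule b) (rule MC_Bianchi[OF Y])
  show "curv_mult X Y [i, j, k, l] + curv_mult X Y [j, k, i, l] + curv_mult X Y [k, i, j, l] = 0"
    using b1[of k i j] b1[of i j k] b1[of j k i] b2[of i j k] b2[of j k i] b2[of k i j]
    unfolding curv_mult_eq[OF X] by argo
qed

section \<open>The Ricci trace of the product\<close>

lemma sum_antisym_zero:
  fixes h :: "'b \<Rightarrow> 'b \<Rightarrow> real"
  assumes "\<And>i j. h j i = - h i j"
  shows "(\<Sum>i\<in>B. \<Sum>j\<in>B. h i j) = 0"
proof -
  have "(\<Sum>i\<in>B. \<Sum>j\<in>B. h i j) = (\<Sum>j\<in>B. \<Sum>i\<in>B. h i j)"
    by (rule sum.swap)
  also have "\<dots> = - (\<Sum>j\<in>B. \<Sum>i\<in>B. h j i)"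
    by (subst assms) (simp add: sum_negf)
  finally show ?thesis by simp
qed

lemma MC_W_ricci: "X \<in> MC_W \<Longrightarrow> (\<Sum>p\<in>Basis. X [p, a, b, p]) = 0"
  by (simp add: MC_W_def ricci_def)

lemma curv_mult_MC_W:
  assumes XW: "X \<in> MC_W" and YW: "Y \<in> MC_W"
  shows "curv_mult X Y \<in> MC_W"
proof -
  note X = MC_W_MC[OF XW] and Y = MC_W_MC[OF YW]
  have "ricci (curv_mult X Y) j k = 0" for j k
  proof -
    \<comment> \<open>Contracting the two middle slots leaves a Ricci trace of
      \<open>Y\<close>.\<close>
    have mid: "(\<Sum>i\<in>Basis. contr X (\<lambda>p q. Y [i, p, q, i]) j k) = 0"
    proof -
      have "(\<Sum>i\<in>Basis. contr X (\<lambda>p q. Y [i, p, q, i]) j k) =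
          (\<Sum>p\<in>Basis. \<Sum>q\<in>Basis. \<Sum>i\<in>Basis. X [p, j, k, q] * Y [i, p, q, i])"
        unfolding contr_def by (subst sum.swap, rule sum.cong[OF refl], rule sum.swap)
      then show ?thesis
        by (simp add: MC_W_ricci[OF YW] flip: sum_distrib_left)
    qed
    \<comment> \<open>Contracting the two traced slots puts the trace on \<open>X\<close>.\<close>
    have out: "(\<Sum>i\<in>Basis. contr X (\<lambda>p q. Y [p, j, k, q]) i i) = 0"
    proof -
      have "(\<Sum>i\<in>Basis. contr X (\<lambda>p q. Y [p, j, k, q]) i i) =
          (\<Sum>p\<in>Basis. \<Sum>q\<in>Basis. \<Sum>i\<in>Basis. X [p, i, i, q] * Y [p, j, k, q])"
        unfolding contr_def by (subst sum.swap, rule sum.cong[OF refl], rule sum.swap)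
      also have "\<dots> = (\<Sum>p\<in>Basis. \<Sum>q\<in>Basis. (\<Sum>i\<in>Basis. X [i, p, q, i]) * Y [p, j, k, q])"
      proof -
        have sw: "X [p, i, i, q] = X [i, p, q, i]" for p i q
          using MC_swap12[OF X, of p i i q] MC_swap34[OF X, of i p i q] by simp
        show ?thesis
          by (simp only: sum_distrib_right, intro sum.cong refl, subst sw) (rule refl)
      qed
      finally show ?thesis
        by (simp add: MC_W_ricci[OF XW])
    qed
    \<comment> \<open>The other four pairs join a traced slot with a middle one and cancel two by
      two: \<open>X\<close> is antisymmetric in \<open>p\<close> and \<open>i\<close>, and its
      cofactor is symmetric in them.\<close>
    have mixed: "(\<Sum>i\<in>Basis. contr X (\<lambda>p q. f p q i) i j) +
        (\<Sum>i\<in>Basis. contr X (\<lambda>p q. f i p q) j i) = 0" for f j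
    proof -
      have "(\<Sum>i\<in>Basis. contr X (\<lambda>p q. f p q i) i j) + (\<Sum>i\<in>Basis. contr X (\<lambda>p q. f i p q) j i) =
          (\<Sum>i\<in>Basis. contr X (\<lambda>p q. f p q i + f i q p) i j)"
        by (subst contr_swap[OF X, of "\<lambda>p q. f _ p q", symmetric])
          (simp only: contr_add sum.distrib)
      also have "\<dots> = (\<Sum>i\<in>Basis. \<Sum>p\<in>Basis. \<Sum>q\<in>Basis. X [p, i, j, q] * (f p q i + f i q p))"
        by (simp add: contr_def)
      also have "\<dots> = 0"
        by (rule sum_antisym_zero, subst sum_negf[symmetric], rule sum.cong[OF refl],
            subst MC_swap12[OF X]) simp
      finally show ?thesis .
    qed
    show ?thesis
      unfolding ricci_def curv_mult_eq[OF X]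
      using mixed[of "\<lambda>p q i. Y [p, q, k, i]" j] mixed[of "\<lambda>p q i. Y [p, j, q, i]" k] mid out
      by (simp add: sum.distrib flip: sum_divide_distrib)
  qed
  then show ?thesis
    using curv_mult_MC[OF X Y] by (simp add: MC_W_def)
qed


section \<open>The inner product\<close>

lemma tensor_inner_product: "inner_product tensor_inner"
  unfolding inner_product_def
proof (intro conjI allI)
  show "linear (tensor_inner X)" for X :: "'a list \<Rightarrow> real"
    by (rule linearI)
      (simp_all add: tensor_inner_def fun_vec_simps distrib_left sum.distrib sum_distrib_left
        mult.left_commute)
  show "tensor_inner X Y = tensor_inner Y X" for X Y :: "'a list \<Rightarrow> real"
    by (simp add: tensor_inner_def mult.commute)
qed

lemmas tensor_inner_commute = ip_commute[OF tensor_inner_product]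
  and tensor_inner_linear_left = ip_linear_left[OF tensor_inner_product]

lemma tensor_inner_pos:
  assumes X: "X \<in> tensors 4" "X \<noteq> 0"
  shows "tensor_inner X X > 0"
proof -
  have "tensor_inner X X \<ge> 0"
    unfolding tensor_inner_def by (intro sum_nonneg) auto
  moreover have "tensor_inner X X \<noteq> 0"
  proof
    assume "tensor_inner X X = 0"
    then have "X [a, b, c, d] = 0"
      if "a \<in> Basis" "b \<in> Basis" "c \<in> Basis" "d \<in> Basis" for a b c d
      using that unfolding tensor_inner_def by (simp add: sum_nonneg_eq_0_iff sum_nonneg)
    then have "X = 0"
      using X by (intro tensors4_ext_Basis) (auto simp: tensors4_iff linear_zero)
    then show False
      using X by simp
  qed
  ultimately show ?thesis by simp
qed

section \<open>Self-adjointness of the multiplication operators\<close>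

definition sum4 :: "('a::euclidean_space \<Rightarrow> 'a \<Rightarrow> 'a \<Rightarrow> 'a \<Rightarrow> real) \<Rightarrow> real"
  where "sum4 F = (\<Sum>i\<in>Basis. \<Sum>j\<in>Basis. \<Sum>k\<in>Basis. \<Sum>l\<in>Basis. F i j k l)"

lemma sum4_swap23: "sum4 F = sum4 (\<lambda>i k j l. F i j k l)"
  unfolding sum4_def by (rule sum.cong[OF refl], rule sum.swap)

lemma sum4_swap34: "sum4 F = sum4 (\<lambda>i j l k. F i j k l)"
  unfolding sum4_def by (rule sum.cong[OF refl], rule sum.cong[OF refl], rule sum.swap)

lemma sum4_swap_pairs: "sum4 F = sum4 (\<lambda>k l i j. F i j k l)"
  unfolding sum4_def by (rule sum_pairs_swap)

lemma sum4_add: "sum4 (\<lambda>i j k l. F i j k l + G i j k l) = sum4 F + sum4 G"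
  and sum4_scale: "sum4 (\<lambda>i j k l. r * F i j k l) = r * sum4 F"
  by (simp_all add: sum4_def sum.distrib sum_distrib_left)

lemma tensor_inner_sum4:
  "tensor_inner X Y = sum4 (\<lambda>i j k l. X [i, j, k, l] * Y [i, j, k, l])"
  by (simp add: tensor_inner_def sum4_def)

text \<open>Each two-slot contraction is self-adjoint. Together with commutativity this makes the
  inner product invariant under the multiplication.\<close>

lemma curv_mult_self_adjoint:
  assumes X: "X \<in> MC"
  shows "tensor_inner (curv_mult X Y) Z = tensor_inner Y (curv_mult X Z)"
proof -
  have adj: "sum4 (\<lambda>i j k l. contr X (f i j) k l * g i j k l) = sum4 (\<lambda>i j k l. f i j k l * contr X (g i j) k l)"
    for f g
    unfolding sum4_def by (intro sum.cong refl contr_self_adjoint X)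
  have 34: "sum4 (\<lambda>i j k l. contr X (\<lambda>p q. Y [i, j, p, q]) k l * Z [i, j, k, l]) =
      sum4 (\<lambda>i j k l. Y [i, j, k, l] * contr X (\<lambda>p q. Z [i, j, p, q]) k l)"
    by (rule adj)
  \<comment> \<open>Reordering the sums brings the contracted slots to the last two places, where
    \<open>adj\<close> applies.\<close>
  have 24: "sum4 (\<lambda>i j k l. contr X (\<lambda>p q. Y [i, p, k, q]) j l * Z [i, j, k, l]) =
      sum4 (\<lambda>i j k l. Y [i, j, k, l] * contr X (\<lambda>p q. Z [i, p, k, q]) j l)"
    by (subst (1 2) sum4_swap23) (rule adj)
  have 23: "sum4 (\<lambda>i j k l. contr X (\<lambda>p q. Y [i, p, q, l]) j k * Z [i, j, k, l]) =
      sum4 (\<lambda>i j k l. Y [i, j, k, l] * contr X (\<lambda>p q. Z [i, p, q, l]) j k)"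
    by (subst (1 2) sum4_swap34, subst (1 2) sum4_swap23) (rule adj)
  have 12: "sum4 (\<lambda>i j k l. contr X (\<lambda>p q. Y [p, q, k, l]) i j * Z [i, j, k, l]) =
      sum4 (\<lambda>i j k l. Y [i, j, k, l] * contr X (\<lambda>p q. Z [p, q, k, l]) i j)"
    by (subst (1 2) sum4_swap_pairs) (rule adj)
  have 13: "sum4 (\<lambda>i j k l. contr X (\<lambda>p q. Y [p, j, q, l]) i k * Z [i, j, k, l]) =
      sum4 (\<lambda>i j k l. Y [i, j, k, l] * contr X (\<lambda>p q. Z [p, j, q, l]) i k)"
    by (subst (1 2) sum4_swap23, subst (1 2) sum4_swap_pairs) (rule adj)
  have 14: "sum4 (\<lambda>i j k l. contr X (\<lambda>p q. Y [p, j, k, q]) i l * Z [i, j, k, l]) =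
      sum4 (\<lambda>i j k l. Y [i, j, k, l] * contr X (\<lambda>p q. Z [p, j, k, q]) i l)"
    by (subst (1 2) sum4_swap34, subst (1 2) sum4_swap23, subst (1 2) sum4_swap_pairs) (rule adj)
  show ?thesis
    unfolding tensor_inner_sum4 curv_mult_eq[OF X] mult.assoc mult.left_commute[of _ "1 / 2"]
      sum4_scale distrib_left distrib_right sum4_add 34 24 23 12 13 14 ..
qed

section \<open>Infinitesimal rotations and reflections\<close>

text \<open>The derivation of tensors induced by \<open>A\<close>. No sign is attached, so this is
  minus the usual action of an endomorphism on covariant tensors.\<close>

definition deriv_act ::
    "('a \<Rightarrow> 'a) \<Rightarrow> ('a::euclidean_space list \<Rightarrow> real) \<Rightarrow> 'a list \<Rightarrow> real"
  where "deriv_act A X = (\<lambda>v. \<Sum>i<length v. X (v[i := A (v ! i)]))"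

lemma deriv_act_eq:
  "deriv_act A X [a, b, c, d] = X [A a, b, c, d] + X [a, A b, c, d] + X [a, b, A c, d] + X [a, b, c, A d]"
  by (simp add: deriv_act_def)

lemma linear_deriv_act: "linear (deriv_act A)"
  by (rule linearI) (auto simp: deriv_act_def fun_vec_simps sum.distrib sum_distrib_left)

lemma deriv_act_tensors:
  assumes A: "linear A" and X: "X \<in> tensors 4"
  shows "deriv_act A X \<in> tensors 4"
  unfolding tensors4_iff
proof (intro conjI allI impI)
  show "deriv_act A X v = 0" if "length v \<noteq> 4" for v
    using that by (simp add: deriv_act_def tensors4_zero[OF X])
qed (unfold deriv_act_eq, (intro linear_compose_add tensors4_linear[OF X]
    linear_compose[OF A tensors4_linear(1)[OF X], unfolded o_def]
    linear_compose[OF A tensors4_linear(2)[OF X], unfolded o_def]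
    linear_compose[OF A tensors4_linear(3)[OF X], unfolded o_def]
    linear_compose[OF A tensors4_linear(4)[OF X], unfolded o_def])+)

definition skew :: "('a::euclidean_space \<Rightarrow> 'a) \<Rightarrow> bool"
  where "skew A \<longleftrightarrow> linear A \<and> (\<forall>x y. A x \<bullet> y = - (x \<bullet> A y))"

lemma linear_Basis_expansion:
  fixes f :: "'a::euclidean_space \<Rightarrow> real"
  assumes "linear f"
  shows "f x = (\<Sum>b\<in>Basis. (x \<bullet> b) * f b)"
proof -
  have "f x = f (\<Sum>b\<in>Basis. (x \<bullet> b) *\<^sub>R b)"
    by (simp add: euclidean_representation)
  also have "\<dots> = (\<Sum>b\<in>Basis. (x \<bullet> b) *\<^sub>R f b)"
    by (rule linear_combination[OF assms])
  finally show ?thesis by simp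
qed

text \<open>The sum is a contraction with the metric, which infinitesimal isometries annihilate.
  This moves \<open>A\<close> from one contracted slot to the other.\<close>

lemma skew_sum_Basis:
  fixes g h :: "'a::euclidean_space \<Rightarrow> real"
  assumes A: "skew A" and g: "linear g" and h: "linear h"
  shows "(\<Sum>p\<in>Basis. g (A p) * h p) = - (\<Sum>p\<in>Basis. g p * h (A p))"
proof -
  have sk: "A p \<bullet> b = - (A b \<bullet> p)" for p b
    using A unfolding skew_def by (metis inner_commute)
  have "(\<Sum>p\<in>Basis. g (A p) * h p) = (\<Sum>p\<in>Basis. \<Sum>b\<in>Basis. (A p \<bullet> b) * g b * h p)"
    unfolding linear_Basis_expansion[OF g, of "A _"] sum_distrib_right ..
  also have "\<dots> = (\<Sum>b\<in>Basis. \<Sum>p\<in>Basis. - ((A b \<bullet> p) * h p * g b))"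
    by (subst sum.swap, rule sum.cong[OF refl], rule sum.cong[OF refl], subst sk)
      (simp only: mult_minus_left mult_ac)
  also have "\<dots> = - (\<Sum>p\<in>Basis. g p * h (A p))"
    unfolding linear_Basis_expansion[OF h, of "A _"] sum_distrib_left sum_negf[symmetric] by (simp only: mult_ac)
  finally show ?thesis .
qed


lemma tensor_inner_deriv_act:
  assumes A: "skew A" and X: "X \<in> tensors 4" and Y: "Y \<in> tensors 4"
  shows "tensor_inner (deriv_act A X) Y = - tensor_inner X (deriv_act A Y)"
proof -
  note LX = tensors4_linear[OF X] and LY = tensors4_linear[OF Y]
  have adj: "sum4 (\<lambda>i j k l. f i j k (A l) * g i j k l) = - 1 * sum4 (\<lambda>i j k l. f i j k l * g i j k (A l))"
    if "\<And>i j k. linear (f i j k)" "\<And>i j k. linear (g i j k)" for f g :: "'a \<Rightarrow> 'a \<Rightarrow> 'a \<Rightarrow> 'a \<Rightarrow> real"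
    unfolding sum4_def sum_distrib_left[symmetric]
    by (simp add: skew_sum_Basis[OF A that] sum_negf)
  have 4: "sum4 (\<lambda>i j k l. X [i, j, k, A l] * Y [i, j, k, l]) =
      - 1 * sum4 (\<lambda>i j k l. X [i, j, k, l] * Y [i, j, k, A l])"
    by (rule adj) (rule LX LY)+
  have 3: "sum4 (\<lambda>i j k l. X [i, j, A k, l] * Y [i, j, k, l]) =
      - 1 * sum4 (\<lambda>i j k l. X [i, j, k, l] * Y [i, j, A k, l])"
    by (subst (1 2) sum4_swap34, rule adj) (rule LX LY)+
  have 2: "sum4 (\<lambda>i j k l. X [i, A j, k, l] * Y [i, j, k, l]) =
      - 1 * sum4 (\<lambda>i j k l. X [i, j, k, l] * Y [i, A j, k, l])"
    by (subst (1 2) sum4_swap_pairs, rule adj) (rule LX LY)+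
  have 1: "sum4 (\<lambda>i j k l. X [A i, j, k, l] * Y [i, j, k, l]) =
      - 1 * sum4 (\<lambda>i j k l. X [i, j, k, l] * Y [A i, j, k, l])"
    by (subst (1 2) sum4_swap_pairs, subst (1 2) sum4_swap34, rule adj) (rule LX LY)+
  show ?thesis
    unfolding tensor_inner_sum4 deriv_act_eq distrib_left distrib_right sum4_add 1 2 3 4 by simp
qed

lemma deriv_act_MC:
  assumes A: "linear A" and X: "X \<in> MC"
  shows "deriv_act A X \<in> MC"
proof (rule MC_I)
  show "deriv_act A X \<in> tensors 4"
    by (rule deriv_act_tensors[OF A MC_tensors[OF X]])
  fix a b c d
  show "deriv_act A X [b, a, c, d] = - deriv_act A X [a, b, c, d]"
    unfolding deriv_act_eq
    using MC_swap12[OF X, of "A b" a c d] MC_swap12[OF X, of b "A a" c d]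
      MC_swap12[OF X, of b a "A c" d] MC_swap12[OF X, of b a c "A d"] by linarith
  show "deriv_act A X [a, b, d, c] = - deriv_act A X [a, b, c, d]"
    unfolding deriv_act_eq
    using MC_swap34[OF X, of "A a" b d c] MC_swap34[OF X, of a "A b" d c]
      MC_swap34[OF X, of a b "A d" c] MC_swap34[OF X, of a b d "A c"] by linarith
  show "deriv_act A X [a, b, c, d] + deriv_act A X [b, c, a, d] + deriv_act A X [c, a, b, d] = 0"
    unfolding deriv_act_eq
    using MC_Bianchi[OF X, of "A a" b c d] MC_Bianchi[OF X, of a "A b" c d]
      MC_Bianchi[OF X, of a b "A c" d] MC_Bianchi[OF X, of a b c "A d"] by linarith
qed

text \<open>With \<open>A\<close> in the two traced slots the terms cancel by skewness; the other
  two terms are Ricci components of \<open>X\<close> itself.\<close>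

lemma deriv_act_MC_W:
  assumes A: "skew A" and XW: "X \<in> MC_W"
  shows "deriv_act A X \<in> MC_W"
proof -
  note X = MC_W_MC[OF XW]
  note T = tensors4_linear[OF MC_tensors[OF X]]
  have lin: "linear A"
    using A by (simp add: skew_def)
  have "ricci (deriv_act A X) a b = 0" for a b
  proof -
    \<comment> \<open>Expanding the last slot replaces its argument by an inner product, to which
      skewness applies.\<close>
    have ex: "X [x, a, b, p] = (\<Sum>q\<in>Basis. (p \<bullet> q) * X [x, a, b, q])" for x p
      by (rule linear_Basis_expansion[OF T(4)])
    have "(\<Sum>p\<in>Basis. X [A p, a, b, p]) =
        (\<Sum>q\<in>Basis. \<Sum>p\<in>Basis. X [A p, a, b, q] * (q \<bullet> p))"
      by (subst ex, subst sum.swap) (simp add: inner_commute mult.commute)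
    also have "\<dots> = (\<Sum>q\<in>Basis. - (\<Sum>p\<in>Basis. X [p, a, b, q] * (q \<bullet> A p)))"
      by (intro sum.cong refl skew_sum_Basis[OF A] T
          bounded_linear.linear[OF bounded_linear_inner_right])
    also have "\<dots> = - (\<Sum>p\<in>Basis. \<Sum>q\<in>Basis. (A p \<bullet> q) * X [p, a, b, q])"
      by (subst sum_negf, subst sum.swap) (simp only: inner_commute mult.commute)
    also have "\<dots> = - (\<Sum>p\<in>Basis. X [p, a, b, A p])"
      unfolding ex[of _ "A _"] ..
    finally have "(\<Sum>p\<in>Basis. X [A p, a, b, p] + X [p, a, b, A p]) = 0"
      by (simp add: sum.distrib)
    then show ?thesis
      using MC_W_ricci[OF XW, of "A a" b] MC_W_ricci[OF XW, of a "A b"]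
      by (simp add: ricci_def deriv_act_eq sum.distrib)
  qed
  then show ?thesis
    using deriv_act_MC[OF lin X] by (simp add: MC_W_def)
qed

text \<open>Skewness moves \<open>A\<close> from the contracted slots of \<open>X\<close> to those
  of \<open>f\<close>, where it cancels the second summand; only the free slots \<open>i\<close> and
  \<open>j\<close> remain.\<close>

lemma contr_deriv_act:
  assumes A: "skew A" and X: "X \<in> tensors 4"
    and f: "\<And>q. linear (\<lambda>p. f p q)" "\<And>p. linear (f p)"
  shows "contr (deriv_act A X) f i j + contr X (\<lambda>p q. f (A p) q + f p (A q)) i j =
    contr X f (A i) j + contr X f i (A j)"
proof -
  note T = tensors4_linear[OF X]
  have 1: "(\<Sum>p\<in>Basis. \<Sum>q\<in>Basis. X [A p, i, j, q] * f p q) =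
      - (\<Sum>p\<in>Basis. \<Sum>q\<in>Basis. X [p, i, j, q] * f (A p) q)"
    by (subst (1 2) sum.swap) (simp add: skew_sum_Basis[OF A T(1) f(1)] sum_negf)
  have 2: "(\<Sum>p\<in>Basis. \<Sum>q\<in>Basis. X [p, i, j, A q] * f p q) =
      - (\<Sum>p\<in>Basis. \<Sum>q\<in>Basis. X [p, i, j, q] * f p (A q))"
    by (simp add: skew_sum_Basis[OF A T(4) f(2)] sum_negf)
  show ?thesis
    using 1 2 by (simp add: contr_def deriv_act_eq distrib_left distrib_right sum.distrib)
qed

text \<open>The product is built from its factors by metric contractions, so infinitesimal
  isometries obey the Leibniz rule. It is checked on each of the six contractions.\<close>

lemma curv_mult_deriv_act:
  assumes A: "skew A" and X: "X \<in> MC" and Y: "Y \<in> tensors 4"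
  shows "deriv_act A (curv_mult X Y) = curv_mult (deriv_act A X) Y + curv_mult X (deriv_act A Y)"
proof -
  have lin: "linear A"
    using A by (simp add: skew_def)
  note DX = deriv_act_MC[OF lin X]
  note T = tensors4_linear[OF Y] and XT = MC_tensors[OF X]
  have "deriv_act A (curv_mult X Y) [i, j, k, l] =
      curv_mult (deriv_act A X) Y [i, j, k, l] + curv_mult X (deriv_act A Y) [i, j, k, l]" for i j k l
    using contr_deriv_act[OF A XT, of "\<lambda>p q. Y [p, q, k, l]" i j, OF T(1) T(2)]
      contr_deriv_act[OF A XT, of "\<lambda>p q. Y [p, j, q, l]" i k, OF T(1) T(3)]
      contr_deriv_act[OF A XT, of "\<lambda>p q. Y [p, j, k, q]" i l, OF T(1) T(4)]
      contr_deriv_act[OF A XT, of "\<lambda>p q. Y [i, p, q, l]" j k, OF T(2) T(3)]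
      contr_deriv_act[OF A XT, of "\<lambda>p q. Y [i, p, k, q]" j l, OF T(2) T(4)]
      contr_deriv_act[OF A XT, of "\<lambda>p q. Y [i, j, p, q]" k l, OF T(3) T(4)]
    unfolding deriv_act_eq curv_mult_eq[OF X] curv_mult_eq[OF DX] contr_add
    by argo
  moreover have "curv_mult (deriv_act A X) Y + curv_mult X (deriv_act A Y) \<in> tensors 4"
    using curv_mult_tensors[OF DX Y] curv_mult_tensors[OF X deriv_act_tensors[OF lin Y]]
    by (simp add: tensors4_iff fun_vec_simps linear_compose_add)
  ultimately show ?thesis
    using deriv_act_tensors[OF lin curv_mult_tensors[OF X Y]]
    by (intro tensors4_ext) (auto simp: fun_vec_simps)
qed

text \<open>For orthonormal \<open>x\<close> and \<open>y\<close>, the generator of the rotation of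
  their plane from \<open>x\<close> towards \<open>y\<close>.\<close>

definition rot :: "'a::euclidean_space \<Rightarrow> 'a \<Rightarrow> 'a \<Rightarrow> 'a"
  where "rot x y z = (z \<bullet> x) *\<^sub>R y - (z \<bullet> y) *\<^sub>R x"

lemma skew_rot: "skew (rot x y)"
  unfolding skew_def
  by (auto simp: rot_def inner_add_left inner_diff_left inner_diff_right algebra_simps inner_commute
      intro!: linearI)

section \<open>Reflections in coordinate hyperplanes\<close>

definition mirror :: "'a::euclidean_space \<Rightarrow> 'a \<Rightarrow> 'a"
  where "mirror e z = z - (2 * (z \<bullet> e)) *\<^sub>R e"

definition mirror_act ::
    "'a::euclidean_space \<Rightarrow> ('a list \<Rightarrow> real) \<Rightarrow> 'a list \<Rightarrow> real"
  where "mirror_act e X = (\<lambda>v. X (map (mirror e) v))"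

lemma mirror_Basis:
  "e \<in> Basis \<Longrightarrow> b \<in> Basis \<Longrightarrow> mirror e b = (if b = e then - b else b)"
  by (simp add: mirror_def inner_Basis scaleR_2)

lemma linear_mirror: "linear (mirror e)"
  by (rule linearI) (simp_all add: mirror_def algebra_simps)

lemma mirror_mirror: "e \<in> Basis \<Longrightarrow> mirror e (mirror e x) = x"
  by (simp add: mirror_def inner_diff_left scaleR_2)

lemma mirror_act_eq: "mirror_act e X [a, b, c, d] = X [mirror e a, mirror e b, mirror e c, mirror e d]"
  by (simp add: mirror_act_def)

lemma linear_mirror_act: "linear (mirror_act e)"
  by (rule linearI) (auto simp: mirror_act_def fun_vec_simps)

lemma mirror_act_mirror_act: "e \<in> Basis \<Longrightarrow> mirror_act e (mirror_act e X) = X"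
  by (rule ext) (simp add: mirror_act_def mirror_mirror o_def)

lemma mirror_act_tensors:
  assumes X: "X \<in> tensors 4"
  shows "mirror_act e X \<in> tensors 4"
  unfolding tensors4_iff
proof (intro conjI allI impI)
  show "mirror_act e X v = 0" if "length v \<noteq> 4" for v
    using that by (simp add: mirror_act_def tensors4_zero[OF X])
qed (unfold mirror_act_eq, (rule linear_compose[OF linear_mirror tensors4_linear(1)[OF X], unfolded o_def]
    linear_compose[OF linear_mirror tensors4_linear(2)[OF X], unfolded o_def]
    linear_compose[OF linear_mirror tensors4_linear(3)[OF X], unfolded o_def]
    linear_compose[OF linear_mirror tensors4_linear(4)[OF X], unfolded o_def])+)

lemma mirror_act_MC:
  assumes X: "X \<in> MC"
  shows "mirror_act e X \<in> MC"
  by (rule MC_I, rule mirror_act_tensors[OF MC_tensors[OF X]])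
    (unfold mirror_act_eq, (rule MC_swap12[OF X] MC_swap34[OF X] MC_Bianchi[OF X])+)

lemma mirror_act_MC_W:
  assumes e: "e \<in> Basis" and XW: "X \<in> MC_W"
  shows "mirror_act e X \<in> MC_W"
proof -
  note X = MC_W_MC[OF XW]
  have "ricci (mirror_act e X) a b = ricci X (mirror e a) (mirror e b)" for a b
    unfolding ricci_def mirror_act_eq
    by (rule sum.cong) (auto simp: mirror_Basis e tensors4_simps[OF MC_tensors[OF X]])
  then show ?thesis
    using mirror_act_MC[OF X] XW by (simp add: MC_W_def)
qed

text \<open>On a basis vector the reflection is a sign, and each summation vector occurs twice, so
  the signs cancel.\<close>

lemma contr_mirror_act:
  assumes e: "e \<in> Basis" and X: "X \<in> tensors 4"
    and f: "\<And>q. linear (\<lambda>p. f p q)" "\<And>p. linear (f p)"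
  shows "contr (mirror_act e X) (\<lambda>p q. f (mirror e p) (mirror e q)) i j = contr X f (mirror e i) (mirror e j)"
  unfolding contr_def mirror_act_eq
  by (intro sum.cong refl)
    (auto simp: mirror_Basis e tensors4_simps[OF X] linear_neg[OF f(1)] linear_neg[OF f(2)])

lemma curv_mult_mirror_act:
  assumes e: "e \<in> Basis" and X: "X \<in> MC" and Y: "Y \<in> MC"
  shows "curv_mult (mirror_act e X) (mirror_act e Y) = mirror_act e (curv_mult X Y)"
proof (rule tensors4_ext)
  note T = tensors4_linear[OF MC_tensors[OF Y]]
  show "curv_mult (mirror_act e X) (mirror_act e Y) \<in> tensors 4" "mirror_act e (curv_mult X Y) \<in> tensors 4"
    by (intro mirror_act_tensors MC_tensors curv_mult_MC mirror_act_MC X Y)+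
  fix i j k l
  note C = contr_mirror_act[OF e MC_tensors[OF X]]
  show "curv_mult (mirror_act e X) (mirror_act e Y) [i, j, k, l] = mirror_act e (curv_mult X Y) [i, j, k, l]"
    unfolding curv_mult_eq[OF mirror_act_MC[OF X]] mirror_act_eq[of e Y] mirror_act_eq[of e "curv_mult X Y"]
      curv_mult_eq[OF X]
    using C[of "\<lambda>p q. Y [p, q, mirror e k, mirror e l]" i j, OF T(1) T(2)]
      C[of "\<lambda>p q. Y [p, mirror e j, q, mirror e l]" i k, OF T(1) T(3)]
      C[of "\<lambda>p q. Y [p, mirror e j, mirror e k, q]" i l, OF T(1) T(4)]
      C[of "\<lambda>p q. Y [mirror e i, p, q, mirror e l]" j k, OF T(2) T(3)]
      C[of "\<lambda>p q. Y [mirror e i, p, mirror e k, q]" j l, OF T(2) T(4)]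
      C[of "\<lambda>p q. Y [mirror e i, mirror e j, p, q]" k l, OF T(3) T(4)]
    by simp
qed

lemma tensor_inner_mirror_act:
  assumes e: "e \<in> Basis" and X: "X \<in> tensors 4" and Y: "Y \<in> tensors 4"
  shows "tensor_inner (mirror_act e X) Y = tensor_inner X (mirror_act e Y)"
  unfolding tensor_inner_def mirror_act_eq
  by (intro sum.cong refl)
    (auto simp: mirror_Basis e tensors4_simps[OF X] tensors4_simps[OF Y])

section \<open>Bases of spaces of curvature tensors\<close>

lemma subspace_tensors4: "subspace (tensors 4 :: ('a::euclidean_space list \<Rightarrow> real) set)"
  unfolding subspace_def
  by (auto simp: tensors4_iff plus_fun_def scaleR_fun_def linear_zero
      intro: linear_compose_add linear_mult_const)

lemma tensors4_finite_span:
  "\<exists>B. finite B \<and> (tensors 4 :: ('a::euclidean_space list \<Rightarrow> real) set) \<subseteq> span B"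
proof -
  \<comment> \<open>Products of four coordinate functions, cut off to lists of length four.\<close>
  define u :: "'a \<times> 'a \<times> 'a \<times> 'a \<Rightarrow> 'a list \<Rightarrow> real" where
    "u = (\<lambda>(a, b, c, d) v. if length v = 4
      then (v ! 0 \<bullet> a) * (v ! 1 \<bullet> b) * (v ! 2 \<bullet> c) * (v ! 3 \<bullet> d) else 0)"
  define I :: "('a \<times> 'a \<times> 'a \<times> 'a) set" where "I = Basis \<times> Basis \<times> Basis \<times> Basis"
  have fin: "finite I"
    by (simp add: I_def)
  have ue: "u (a, b, c, d) [x, y, z, w] = (x \<bullet> a) * (y \<bullet> b) * (z \<bullet> c) * (w \<bullet> d)" for a b c d x y z w
    by (simp add: u_def)
  have "u (a, b, c, d) \<in> tensors 4" for a b c d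
    unfolding tensors4_iff
  proof (intro conjI allI impI)
    show "u (a, b, c, d) v = 0" if "length v \<noteq> 4" for v
      using that by (simp add: u_def)
  qed (unfold ue, (intro linear_mult_const bounded_linear.linear[OF bounded_linear_inner_left])+)
  then have uT: "u t \<in> tensors 4" for t
    by (cases t) auto
  have "X \<in> span (u ` I)" if X: "X \<in> tensors 4" for X
  proof -
    let ?S = "\<Sum>t\<in>I. (case t of (a, b, c, d) \<Rightarrow> X [a, b, c, d]) *\<^sub>R u t"
    have "X = ?S"
    proof (rule tensors4_ext_Basis[OF X])
      show "?S \<in> tensors 4"
        by (intro subspace_sum subspace_scale subspace_tensors4 uT)
      fix a b c d :: 'a assume B: "a \<in> Basis" "b \<in> Basis" "c \<in> Basis" "d \<in> Basis"
      have "?S [a, b, c, d] = (\<Sum>t\<in>I. if t = (a, b, c, d) then X [a, b, c, d] else 0)"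
        unfolding sum_fun_apply
        by (rule sum.cong[OF refl]) (auto simp: I_def scaleR_fun_apply ue inner_Basis B split: prod.splits)
      then show "X [a, b, c, d] = ?S [a, b, c, d]"
        using fin B by (simp add: I_def)
    qed
    moreover have "?S \<in> span (u ` I)"
      by (intro span_sum span_scale span_base) auto
    ultimately show ?thesis by simp
  qed
  then show ?thesis
    using fin by (intro exI[of _ "u ` I"]) auto
qed

lemma subspace_finite_span:
  fixes U :: "('a::euclidean_space list \<Rightarrow> real) set"
  assumes "subspace U" "U \<subseteq> tensors 4"
  obtains B where "finite B" "span B = U"
proof -
  obtain T where T: "finite T" "(tensors 4 :: ('a list \<Rightarrow> real) set) \<subseteq> span T"
    using tensors4_finite_span by blast
  obtain B where B: "B \<subseteq> U" "independent B" "U \<subseteq> span B"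
    using basis_exists[of U] by metis
  have "finite B"
    using B assms T independent_span_bound[of T B] by (meson order_trans)
  moreover have "span B = U"
    using B(1,3) assms(1) by (rule span_subspace)
  ultimately show thesis
    using that by blast
qed

lemma orthonormal_basis_exists:
  fixes U :: "('a::euclidean_space list \<Rightarrow> real) set"
  assumes "subspace U" "U \<subseteq> tensors 4"
  obtains E where "orthonormal_basis tensor_inner U E"
proof -
  obtain B where "finite B" "span B = U"
    using subspace_finite_span[OF assms] .
  moreover have "\<exists>E. orthonormal_basis tensor_inner (span B) E"
    by (rule orthonormal_basis_span_exists[OF tensor_inner_product \<open>finite B\<close>])
      (use \<open>span B = U\<close> assms(2) tensor_inner_pos in blast)
  ultimately show thesis
    using that by auto
qed

text \<open>\<open>P\<close> is the orthogonal projection onto \<open>U\<close>, given by Fourier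
  coefficients and therefore linear on all functions of lists.\<close>

lemma orthogonal_decomposition:
  fixes U :: "('a::euclidean_space list \<Rightarrow> real) set"
  assumes U: "subspace U" "U \<subseteq> tensors 4"
  obtains P where "linear P" "\<And>X. P X \<in> U" "\<And>X. X \<in> U \<Longrightarrow> P X = X"
    "\<And>X Y. Y \<in> U \<Longrightarrow> tensor_inner (X - P X) Y = 0"
proof -
  obtain E where E: "orthonormal_basis tensor_inner U E"
    using orthonormal_basis_exists[OF U] .
  define P where "P X = (\<Sum>e\<in>E. tensor_inner X e *\<^sub>R e)" for X
  have E': "finite E" "E \<subseteq> U" "\<And>X. X \<in> U \<Longrightarrow> P X = X"
    "\<And>d e. d \<in> E \<Longrightarrow> e \<in> E \<Longrightarrow> tensor_inner d e = (if d = e then 1 else 0)"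
    using E by (auto simp: orthonormal_basis_def P_def)
  have "linear P"
    by (rule linearI) (simp_all add: P_def linear_add[OF tensor_inner_linear_left]
        linear_scale[OF tensor_inner_linear_left] scaleR_add_left sum.distrib scaleR_sum_right)
  moreover have "P X \<in> U" for X
    unfolding P_def using E' U by (intro subspace_sum subspace_scale) auto
  moreover have "tensor_inner (X - P X) Y = 0" if Y: "Y \<in> U" for X Y
  proof -
    have e: "tensor_inner (X - P X) e = 0" if "e \<in> E" for e
    proof -
      have "tensor_inner (P X) e = (\<Sum>d\<in>E. if d = e then tensor_inner X d else 0)"
        unfolding P_def ip_sum_left[OF tensor_inner_product]
        by (rule sum.cong) (use that E' in auto)
      then show ?thesis
        using that E' by (simp add: linear_diff[OF tensor_inner_linear_left])
    qed
    have "tensor_inner (X - P X) Y = tensor_inner (X - P X) (P Y)"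
      using E'(3)[OF Y] by simp
    also have "\<dots> = 0"
      by (simp add: P_def[of Y] ip_sum_right[OF tensor_inner_product] e)
    finally show ?thesis .
  qed
  ultimately show thesis
    using that E'(3) by blast
qed

lemma subspace_eqI_orthogonal:
  fixes U W :: "('a::euclidean_space list \<Rightarrow> real) set"
  assumes "subspace U" "subspace W" "U \<subseteq> W" "W \<subseteq> tensors 4"
    and zero: "\<And>Y. Y \<in> W \<Longrightarrow> (\<And>X. X \<in> U \<Longrightarrow> tensor_inner X Y = 0) \<Longrightarrow> Y = 0"
  shows "U = W"
proof -
  have UT: "U \<subseteq> tensors 4"
    using assms by blast
  obtain P where P: "linear P" "\<And>X. P X \<in> U" "\<And>X. X \<in> U \<Longrightarrow> P X = X"
    "\<And>X Y. Y \<in> U \<Longrightarrow> tensor_inner (X - P X) Y = 0"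
    using orthogonal_decomposition[OF assms(1) UT] by blast
  have "X \<in> U" if "X \<in> W" for X
  proof -
    have "X - P X \<in> W"
      using that P(2) assms by (intro subspace_diff) auto
    then have "X - P X = 0"
      using zero P(4) by (metis tensor_inner_commute)
    then show ?thesis
      using P(2)[of X] by simp
  qed
  then show ?thesis
    using assms by blast
qed


section \<open>Spanning by a single orbit\<close>

definition wedge :: "'a::euclidean_space \<Rightarrow> 'a \<Rightarrow> 'a \<Rightarrow> 'a \<Rightarrow> real"
  where "wedge a b x y = (x \<bullet> a) * (y \<bullet> b) - (y \<bullet> a) * (x \<bullet> b)"

text \<open>The image of \<open>(a b)(c d)\<close>, a product of symmetric products, under the Young symmetrizer, up to a
  factor.\<close>

definition gen :: "'a::euclidean_space \<Rightarrow> 'a \<Rightarrow> 'a \<Rightarrow> 'a \<Rightarrow> 'a list \<Rightarrow> real"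
  where "gen a b c d = (\<lambda>v. if length v = 4 then
      wedge a c (v ! 0) (v ! 1) * wedge b d (v ! 2) (v ! 3) +
      wedge b d (v ! 0) (v ! 1) * wedge a c (v ! 2) (v ! 3) +
      wedge a d (v ! 0) (v ! 1) * wedge b c (v ! 2) (v ! 3) +
      wedge b c (v ! 0) (v ! 1) * wedge a d (v ! 2) (v ! 3) else 0)"

lemma gen_eq:
  "gen a b c d [x, y, z, w] = wedge a c x y * wedge b d z w + wedge b d x y * wedge a c z w +
    wedge a d x y * wedge b c z w + wedge b c x y * wedge a d z w"
  by (simp add: gen_def)

lemma linear_wedge: "linear (\<lambda>x. wedge a b x y)" "linear (\<lambda>y. wedge a b x y)"
  by (rule linearI; simp add: wedge_def inner_add_left algebra_simps)+

lemma wedge_swap: "wedge a b y x = - wedge a b x y"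
  by (simp add: wedge_def)

lemma gen_MC: "gen a b c d \<in> MC"
proof (rule MC_I)
  show "gen a b c d \<in> tensors 4"
    unfolding tensors4_iff
  proof (intro conjI allI impI)
    show "gen a b c d v = 0" if "length v \<noteq> 4" for v
      using that by (simp add: gen_def)
  qed (unfold gen_eq, (intro linear_compose_add linear_mult_const linear_wedge)+)
  fix x y z w
  show "gen a b c d [y, x, z, w] = - gen a b c d [x, y, z, w]"
    unfolding gen_eq wedge_swap[of _ _ y x] by simp
  show "gen a b c d [x, y, w, z] = - gen a b c d [x, y, z, w]"
    unfolding gen_eq wedge_swap[of _ _ w z] by simp
  show "gen a b c d [x, y, z, w] + gen a b c d [y, z, x, w] + gen a b c d [z, x, y, w] = 0"
    unfolding gen_eq wedge_def by algebra
qed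

lemma gen_swap12: "gen b a c d = gen a b c d"
  and gen_swap34: "gen a b d c = gen a b c d"
  and gen_swap_pairs: "gen c d a b = gen a b c d"
  by (rule ext; simp add: gen_def wedge_def algebra_simps)+

lemma gen_zero: "gen 0 b c d = 0" "gen a 0 c d = 0" "gen a b 0 d = 0" "gen a b c 0 = 0"
  by (rule ext; simp add: gen_def wedge_def)+

lemma gen_minus:
  "gen (- a) b c d = - gen a b c d" "gen a (- b) c d = - gen a b c d"
  "gen a b (- c) d = - gen a b c d" "gen a b c (- d) = - gen a b c d"
  by (rule ext; simp add: gen_def wedge_def algebra_simps)+

text \<open>Skewness carries \<open>A\<close> from the arguments over to the vectors
  \<open>a, b, c, d\<close>, whence the minus sign.\<close>

lemma deriv_act_gen:
  assumes A: "skew A"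
  shows "deriv_act A (gen a b c d) =
    - (gen (A a) b c d + gen a (A b) c d + gen a b (A c) d + gen a b c (A d))" (is "?L = ?R")
proof (rule tensors4_ext)
  have lin: "linear A" and sk: "A x \<bullet> y = - (x \<bullet> A y)" for x y
    using A by (auto simp: skew_def)
  show "?L \<in> tensors 4"
    by (rule deriv_act_tensors[OF lin MC_tensors[OF gen_MC]])
  show "?R \<in> tensors 4"
    by (intro subspace_add subspace_neg subspace_tensors4 MC_tensors[OF gen_MC])
  show "?L [x, y, z, w] = ?R [x, y, z, w]" for x y z w
    unfolding deriv_act_eq gen_eq fun_vec_simps wedge_def sk by algebra
qed

text \<open>Every term of \<open>gen\<close> multiplies two-forms on disjoint pairs of basis
  vectors, so inserting the same basis vector into both factors gives zero. The trace vanishes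
  termwise.\<close>

lemma gen_MC_W:
  assumes "a \<in> Basis" "b \<in> Basis" "c \<in> Basis" "d \<in> Basis" "distinct [a, b, c, d]"
  shows "gen a b c d \<in> MC_W"
proof -
  have "gen a b c d [p, x, y, p] = 0" if "p \<in> Basis" for p x y
    using assms that by (auto simp: gen_eq wedge_def inner_Basis)
  then show ?thesis
    using gen_MC[of a b c d] by (simp add: MC_W_def ricci_def)
qed

lemma sum_wedge:
  assumes f: "\<And>y. linear (\<lambda>x. f x y)" "\<And>x. linear (f x)"
  shows "(\<Sum>x\<in>Basis. \<Sum>y\<in>Basis. wedge a b x y * f x y) = f a b - f b a"
proof -
  have ex: "f u v = (\<Sum>x\<in>Basis. \<Sum>y\<in>Basis. (x \<bullet> u) * (y \<bullet> v) * f x y)" for u v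
    by (subst linear_Basis_expansion[OF f(1)], subst linear_Basis_expansion[OF f(2)])
      (simp add: sum_distrib_left inner_commute mult.assoc)
  show ?thesis
    unfolding ex[of a b] ex[of b a] wedge_def left_diff_distrib sum_subtractf
    by (simp only: mult_ac)
qed

text \<open>Each of the four products of two-forms contributes four times one component of
  \<open>Y\<close>, and pair symmetry merges them into two. Orthogonality to generators thus becomes
  a linear relation between components.\<close>

lemma tensor_inner_gen:
  assumes Y: "Y \<in> MC"
  shows "tensor_inner (gen a b c d) Y = 8 * (Y [a, c, b, d] + Y [a, d, b, c])"
proof -
  note T = tensors4_linear[OF MC_tensors[OF Y]]
  have w: "sum4 (\<lambda>x y z w. wedge a b x y * wedge c d z w * Y [x, y, z, w]) = 4 * Y [a, b, c, d]"
    for a b c d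
  proof -
    have "(\<Sum>z\<in>Basis. \<Sum>w\<in>Basis. wedge a b x y * wedge c d z w * Y [x, y, z, w]) =
        wedge a b x y * (2 * Y [x, y, c, d])" for x y
      using sum_wedge[of "\<lambda>z w. Y [x, y, z, w]" c d, OF T(3) T(4)] MC_swap34[OF Y, of x y d c]
      by (simp add: mult.assoc flip: sum_distrib_left)
    then have "sum4 (\<lambda>x y z w. wedge a b x y * wedge c d z w * Y [x, y, z, w]) =
        2 * (\<Sum>x\<in>Basis. \<Sum>y\<in>Basis. wedge a b x y * Y [x, y, c, d])"
      by (simp add: sum4_def sum_distrib_left mult_ac)
    also have "\<dots> = 2 * (Y [a, b, c, d] - Y [b, a, c, d])"
      by (simp add: sum_wedge[of "\<lambda>x y. Y [x, y, c, d]", OF T(1) T(2)])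
    finally show ?thesis
      using MC_swap12[OF Y, of b a c d] by simp
  qed
  have "tensor_inner (gen a b c d) Y = 4 * Y [a, c, b, d] + 4 * Y [b, d, a, c] +
      4 * Y [a, d, b, c] + 4 * Y [b, c, a, d]"
    unfolding tensor_inner_sum4 gen_eq distrib_right sum4_add w ..
  then show ?thesis
    using MC_pair[OF Y, of b d a c] MC_pair[OF Y, of b c a d] by simp
qed

section \<open>A criterion for a Weyl tensor to vanish\<close>

lemma obtain_Basis_not_in:
  fixes S :: "'a::euclidean_space set"
  assumes "finite S" "card S < DIM('a)"
  obtains e :: 'a where "e \<in> Basis" "e \<notin> S"
  using assms card_mono[of S "Basis :: 'a set"] by (metis not_less subsetI)

text \<open>The values at \<open>a\<close> and \<open>b\<close> cancel, so the vanishing sum is a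
  positive multiple of the constant value elsewhere. This is how tracelessness enters below.\<close>

lemma sum_Basis_two_const:
  fixes f :: "'a::euclidean_space \<Rightarrow> real"
  assumes ab: "a \<in> Basis" "b \<in> Basis" "a \<noteq> b" and "f a + f b = 0" and sum: "(\<Sum>p\<in>Basis. f p) = 0"
    and const: "\<And>p q. p \<in> Basis - {a, b} \<Longrightarrow> q \<in> Basis - {a, b} \<Longrightarrow> f p = f q"
    and c: "c \<in> Basis - {a, b}"
  shows "f c = 0"
proof -
  have "(\<Sum>p\<in>Basis. f p) = f a + (f b + (\<Sum>p\<in>Basis - {a} - {b}. f p))"
    using ab by (simp add: sum.remove[of _ a] sum.remove[of "Basis - {a}" b])
  also have "Basis - {a} - {b} = Basis - {a, b}"
    by auto
  also have "(\<Sum>p\<in>Basis - {a, b}. f p) = (\<Sum>p\<in>Basis - {a, b}. f c)"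
    by (rule sum.cong[OF refl]) (rule const[OF _ c])
  also have "\<dots> = of_nat (card (Basis - {a, b})) * f c"
    by (rule sum_constant)
  finally have "of_nat (card (Basis - {a, b})) * f c = 0"
    using assms(4) sum by linarith
  moreover have "card (Basis - {a, b}) \<noteq> 0"
    using c by auto
  ultimately show ?thesis by simp
qed

text \<open>Components are treated by the number of distinct indices: four by \<open>off\<close> and
  the Bianchi identity, three by \<open>half\<close> and the Ricci trace, two by \<open>diag\<close>
  and the Ricci trace used twice.\<close>

lemma MC_W_eq_zeroI:
  fixes Y :: "'a::euclidean_space list \<Rightarrow> real"
  assumes dim: "DIM('a) \<ge> 4" and YW: "Y \<in> MC_W"
    and off: "\<And>a b c d. a \<in> Basis \<Longrightarrow> b \<in> Basis \<Longrightarrow> c \<in> Basis \<Longrightarrow> d \<in> Basis \<Longrightarrow>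
      distinct [a, b, c, d] \<Longrightarrow> Y [a, c, b, d] + Y [a, d, b, c] = 0"
    and half: "\<And>a b c d. a \<in> Basis \<Longrightarrow> b \<in> Basis \<Longrightarrow> c \<in> Basis \<Longrightarrow> d \<in> Basis \<Longrightarrow>
      distinct [a, b, c, d] \<Longrightarrow> Y [a, c, b, c] = Y [a, d, b, d]"
    and diag: "\<And>a b c d. a \<in> Basis \<Longrightarrow> b \<in> Basis \<Longrightarrow> c \<in> Basis \<Longrightarrow> d \<in> Basis \<Longrightarrow>
      distinct [a, b, c, d] \<Longrightarrow> Y [a, c, a, c] - Y [b, c, b, c] = Y [a, d, a, d] - Y [b, d, b, d]"
  shows "Y = 0"
proof -
  note Y = MC_W_MC[OF YW]
  have sw: "Y [p, x, y, p] = - Y [x, p, y, p]" for p x y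
    by (rule MC_swap12[OF Y])
  have same: "Y [x, x, y, z] = 0" "Y [y, z, x, x] = 0" for x y z
    using MC_swap12[OF Y, of x x y z] MC_swap34[OF Y, of y z x x] by linarith+
  have all4: "Y [a, b, c, d] = 0"
    if "a \<in> Basis" "b \<in> Basis" "c \<in> Basis" "d \<in> Basis" "distinct [a, b, c, d]" for a b c d
  proof -
    \<comment> \<open>These relations turn the Bianchi sum into three times
      \<open>Y [a, b, c, d]\<close>.\<close>
    have "Y [c, b, a, d] = - Y [c, d, a, b]" "Y [c, a, b, d] = - Y [c, d, b, a]"
      using off[of c a b d] off[of c b a d] that by auto
    then show ?thesis
      using MC_Bianchi[OF Y, of a b c d] MC_swap12[OF Y, of b c a d] MC_swap34[OF Y, of c d b a]
        MC_pair[OF Y, of c d a b] by linarith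
  qed
  have two: "Y [a, c, b, c] = 0"
    if abc: "a \<in> Basis" "b \<in> Basis" "c \<in> Basis" "distinct [a, b, c]" for a b c
  proof (rule sum_Basis_two_const[of a b "\<lambda>p. Y [a, p, b, p]"])
    show "(\<Sum>p\<in>Basis. Y [a, p, b, p]) = 0"
      using MC_W_ricci[OF YW, of a b] unfolding sw[of _ a] sum_negf by simp
    show "Y [a, p, b, p] = Y [a, q, b, q]" if "p \<in> Basis - {a, b}" "q \<in> Basis - {a, b}" for p q
      using half[of a b p q] that abc by (cases "p = q") auto
  qed (use abc same in auto)
  have sum2: "(\<Sum>p\<in>Basis. Y [a, p, a, p]) = 0" for a
    using MC_W_ricci[OF YW, of a a] unfolding sw[of _ a] sum_negf by simp
  have rev2: "Y [b, a, b, a] = Y [a, b, a, b]" for a b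
    using MC_rev[OF Y, of b a b a] by simp
  have const2: "Y [a, c, a, c] = Y [b, c, b, c]"
    if "a \<in> Basis" "b \<in> Basis" "c \<in> Basis" "distinct [a, b, c]" for a b c
  proof -
    \<comment> \<open>The function summed here takes opposite values at \<open>a\<close> and
      \<open>b\<close> by reversal symmetry, and its sum is a difference of two vanishing Ricci
      components.\<close>
    have "Y [a, c, a, c] - Y [b, c, b, c] = 0"
    proof (rule sum_Basis_two_const[of a b "\<lambda>p. Y [a, p, a, p] - Y [b, p, b, p]"])
      show "(Y [a, a, a, a] - Y [b, a, b, a]) + (Y [a, b, a, b] - Y [b, b, b, b]) = 0"
        using rev2[of a b] by (simp add: same)
      show "(\<Sum>p\<in>Basis. Y [a, p, a, p] - Y [b, p, b, p]) = 0"
        by (simp add: sum_subtractf sum2)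
      show "Y [a, p, a, p] - Y [b, p, b, p] = Y [a, q, a, q] - Y [b, q, b, q]"
        if "p \<in> Basis - {a, b}" "q \<in> Basis - {a, b}" for p q
        using diag[of a b p q] that \<open>a \<in> Basis\<close> \<open>b \<in> Basis\<close> \<open>distinct [a, b, c]\<close>
        by (cases "p = q") auto
    qed (use that in auto)
    then show ?thesis by simp
  qed
  have one: "Y [a, c, a, c] = 0" if ac: "a \<in> Basis" "c \<in> Basis" "a \<noteq> c" for a c
  proof -
    obtain b :: 'a where b: "b \<in> Basis" "b \<notin> {a, c}"
      using obtain_Basis_not_in[of "{a, c}"] dim ac by auto
    \<comment> \<open>All \<open>p\<close> other than \<open>c\<close> give the same value, so the
      Ricci component at \<open>c\<close> is, up to sign, \<open>DIM('a) - 1\<close> times that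
      value.\<close>
    have k: "Y [c, p, c, p] = Y [a, c, a, c]" if "p \<in> Basis" "p \<noteq> c" for p
      using const2[of a p c] ac that rev2[of c p] by (cases "a = p") auto
    have "0 = (\<Sum>p\<in>Basis - {c}. Y [c, p, c, p])"
      using sum2[of c] ac by (simp add: sum.remove[of _ c] same)
    also have "\<dots> = of_nat (card (Basis - {c})) * Y [a, c, a, c]"
      by (simp add: k)
    finally show ?thesis
      using dim ac by simp
  qed
  show ?thesis
  proof (rule tensors4_ext_Basis[OF MC_tensors[OF Y] subspace_0[OF subspace_tensors4]])
    fix a b c d :: 'a assume B: "a \<in> Basis" "b \<in> Basis" "c \<in> Basis" "d \<in> Basis"
    have "Y [a, b, c, d] = 0"
    proof (cases "a = b \<or> c = d \<or> distinct [a, b, c, d]")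
      case True
      then show ?thesis
        using same all4 B by auto
    next
      case False
      then have ne: "a \<noteq> b" "c \<noteq> d" and "a = c \<or> a = d \<or> b = c \<or> b = d"
        by auto
      then consider "a = c" "b = d" | "a = d" "b = c" | "a = c" "b \<noteq> d" | "a = d" "b \<noteq> c"
        | "b = c" "a \<noteq> d" | "b = d" "a \<noteq> c"
        by auto
      then show ?thesis
      proof cases
        case 1 then show ?thesis using one[of a b] B ne by simp
      next
        case 2 then show ?thesis
          using one[of a b] B ne
            MC_swap34[OF Y, of a b b a] by simp
      next
        case 3 then show ?thesis
          using two[of b d a] B ne MC_swap12[OF Y, of a b a d] MC_swap34[OF Y, of b a a d] by simp
      next
        case 4 then show ?thesis
          using two[of b c a] B ne MC_swap12[OF Y, of a b c a] by simp
      next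
        case 5 then show ?thesis
          using two[of a d b] B ne MC_swap34[OF Y, of a b b d] by simp
      next
        case 6 then show ?thesis
          using two[of a c b] B ne by simp
      qed
    qed
    then show "Y [a, b, c, d] = (0 :: 'a list \<Rightarrow> real) [a, b, c, d]"
      by simp
  qed
qed

section \<open>Coordinate rotations acting on the generators\<close>

lemma rot_Basis:
  assumes "x \<in> Basis" "y \<in> Basis" "x \<noteq> y"
  shows "rot x y x = y" "rot x y y = - x" "z \<in> Basis \<Longrightarrow> z \<noteq> x \<Longrightarrow> z \<noteq> y \<Longrightarrow> rot x y z = 0"
  using assms by (auto simp: rot_def inner_Basis)

lemma rot_zero: "rot x y 0 = 0"
  and rot_minus: "rot x y (- z) = - rot x y z"
  by (simp_all add: rot_def)

lemma deriv_act_linear_simps: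
  "deriv_act A (X + Y) = deriv_act A X + deriv_act A Y"
  "deriv_act A (X - Y) = deriv_act A X - deriv_act A Y"
  "deriv_act A (- X) = - deriv_act A X"
  "deriv_act A (r *\<^sub>R X) = r *\<^sub>R deriv_act A X"
  "deriv_act A 0 = 0"
  by (simp_all add: linear_add linear_diff linear_neg linear_scale linear_0 linear_deriv_act)

text \<open>On the symmetric product of \<open>a\<close> and \<open>b\<close> the rotation in their
  plane has weight two, whence the factor -4. Rotations within a pair produce the repeated entries
  tested in \<open>MC_W_eq_zeroI\<close>; a rotation across the pairs exchanges \<open>a\<close>
  with \<open>c\<close>.\<close>

lemma
  assumes B: "a \<in> Basis" "b \<in> Basis" "c \<in> Basis" "d \<in> Basis" and dist: "distinct [a, b, c, d]"
  shows deriv_act_rot_gen34: "deriv_act (rot c d) (gen a b c d) = gen a b c c - gen a b d d"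
    and deriv_act_rot_gen12: "deriv_act (rot a b) (gen a b c c - gen a b d d) =
      gen a a c c - gen b b c c - (gen a a d d - gen b b d d)"
    and deriv_act_rot_gen12_twice:
      "deriv_act (rot a b) (deriv_act (rot a b) (gen a b c d)) = - 4 *\<^sub>R gen a b c d"
    and deriv_act_rot_gen13_twice:
      "deriv_act (rot a c) (deriv_act (rot a c) (gen a b c d)) = - 2 *\<^sub>R (gen a b c d + gen c b a d)"
proof -
  note simps = deriv_act_gen[OF skew_rot] gen_zero gen_minus
  have ab: "rot a b a = b" "rot a b b = - a" "rot a b c = 0" "rot a b d = 0"
    and cd: "rot c d a = 0" "rot c d b = 0" "rot c d c = d" "rot c d d = - c"
    and ac: "rot a c a = c" "rot a c b = 0" "rot a c c = - a" "rot a c d = 0"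
    using B dist by (auto simp: rot_Basis)
  show "deriv_act (rot c d) (gen a b c d) = gen a b c c - gen a b d d"
    by (simp add: simps cd)
  show "deriv_act (rot a b) (gen a b c c - gen a b d d) =
      gen a a c c - gen b b c c - (gen a a d d - gen b b d d)"
    by (simp add: simps ab deriv_act_linear_simps)
  have 1: "deriv_act (rot a b) (gen a b c d) = gen a a c d - gen b b c d"
    by (simp add: simps ab)
  have 2: "deriv_act (rot a b) (gen a a c d) = - (gen a b c d + gen a b c d)"
    by (simp add: simps ab gen_swap12[of b a])
  have 3: "deriv_act (rot a b) (gen b b c d) = gen a b c d + gen a b c d"
    by (simp add: simps ab gen_swap12[of b a])
  show "deriv_act (rot a b) (deriv_act (rot a b) (gen a b c d)) = - 4 *\<^sub>R gen a b c d"
    by (simp only: 1 2 3 deriv_act_linear_simps) (simp add: fun_eq_iff fun_vec_simps)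
  have 4: "deriv_act (rot a c) (gen a b c d) = gen a b a d - gen c b c d"
    by (simp add: simps ac)
  have 5: "deriv_act (rot a c) (gen a b a d) = - (gen c b a d + gen a b c d)"
    by (simp add: simps ac)
  have 6: "deriv_act (rot a c) (gen c b c d) = gen a b c d + gen c b a d"
    by (simp add: simps ac)
  show "deriv_act (rot a c) (deriv_act (rot a c) (gen a b c d)) = - 2 *\<^sub>R (gen a b c d + gen c b a d)"
    by (simp only: 4 5 6 deriv_act_linear_simps) (simp add: fun_eq_iff fun_vec_simps)
qed

text \<open>A plane containing just one of the four vectors gives weight one. The first formula
  replaces \<open>a\<close> by a new basis vector.\<close>

lemma
  assumes B: "a \<in> Basis" "b \<in> Basis" "c \<in> Basis" "d \<in> Basis" "e \<in> Basis"
    and dist: "distinct [a, b, c, d, e]"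
  shows deriv_act_rot_gen_new: "deriv_act (rot a e) (gen a b c d) = - gen e b c d"
    and deriv_act_rot_gen_new_twice:
      "deriv_act (rot a e) (deriv_act (rot a e) (gen a b c d)) = - gen a b c d"
proof -
  have r: "rot a e a = e" "rot a e e = - a" "rot a e b = 0" "rot a e c = 0" "rot a e d = 0"
    using B dist by (auto simp: rot_Basis)
  show "deriv_act (rot a e) (gen a b c d) = - gen e b c d"
    by (simp add: deriv_act_gen[OF skew_rot] gen_zero r)
  then show "deriv_act (rot a e) (deriv_act (rot a e) (gen a b c d)) = - gen a b c d"
    by (simp add: deriv_act_gen[OF skew_rot] gen_zero gen_minus r deriv_act_linear_simps)
qed

text \<open>Rotations permute and replace the entries of the given generator, so \<open>U\<close>
  contains every generator with distinct basis entries. Then nothing nonzero in \<open>MC_W\<close>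
  is orthogonal to \<open>U\<close>.\<close>

lemma gen_orbit_span:
  fixes U :: "('a::euclidean_space list \<Rightarrow> real) set"
  assumes dim: "DIM('a) \<ge> 4" and U: "subspace U" "U \<subseteq> MC_W"
    and D: "\<And>x y X. x \<in> Basis \<Longrightarrow> y \<in> Basis \<Longrightarrow> X \<in> U \<Longrightarrow> deriv_act (rot x y) X \<in> U"
    and B: "a \<in> Basis" "b \<in> Basis" "c \<in> Basis" "d \<in> Basis" "distinct [a, b, c, d]"
    and gen: "gen a b c d \<in> U"
  shows "U = MC_W"
proof -
  define R where "R a b c d \<longleftrightarrow> {a, b, c, d} \<subseteq> Basis \<and> distinct [a, b, c, d] \<and> gen a b c d \<in> U" for a b c d
  have R12: "R b a c d" and R34: "R a b d c" and R13: "R c b a d" if "R a b c d" for a b c d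
  proof -
    have R: "a \<in> Basis" "b \<in> Basis" "c \<in> Basis" "d \<in> Basis" "distinct [a, b, c, d]" "gen a b c d \<in> U"
      using that by (auto simp: R_def)
    show "R b a c d" "R a b d c"
      using R by (auto simp: R_def gen_swap12[of b a] gen_swap34[of a b d c])
    have "gen c b a d = - (1 / 2) *\<^sub>R deriv_act (rot a c) (deriv_act (rot a c) (gen a b c d)) - gen a b c d"
      by (simp add: deriv_act_rot_gen13_twice[OF R(1-5)] fun_eq_iff fun_vec_simps)
    also have "\<dots> \<in> U"
      using R by (intro subspace_diff subspace_scale U D)
    finally show "R c b a d"
      using R by (auto simp: R_def)
  qed
  have new: "R e b c d" if "R a b c d" "e \<in> Basis" "e \<notin> {b, c, d}" for a b c d e
  proof (cases "e = a")
    case False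
    have R: "a \<in> Basis" "b \<in> Basis" "c \<in> Basis" "d \<in> Basis" "e \<in> Basis" "distinct [a, b, c, d, e]"
      "gen a b c d \<in> U"
      using that False by (auto simp: R_def)
    have "gen e b c d = - deriv_act (rot a e) (gen a b c d)"
      by (simp add: deriv_act_rot_gen_new[OF R(1-6)])
    also have "\<dots> \<in> U"
      using R by (intro subspace_neg U D)
    finally show ?thesis
      using R by (auto simp: R_def)
  qed (use that in auto)
  \<comment> \<open>The wanted vectors are put in place from the first slot to the last: one that
    already occurs is moved there by a permutation, any other is brought in by
    \<open>new\<close>.\<close>
  have S1: "\<exists>b' c' d'. R e b' c' d'" if "R a b c d" "e \<in> Basis" for a b c d e
    using that new R12 R13 R34 by (metis insertE empty_iff)
  have S2: "\<exists>c' d'. R a f c' d'" if "R a b c d" "f \<in> Basis" "f \<noteq> a" for a b c d f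
    using that new R12 R13 R34 by (metis insertE empty_iff)
  have S3: "\<exists>d'. R a b g d'" if "R a b c d" "g \<in> Basis" "g \<notin> {a, b}" for a b c d g
    using that new R12 R13 R34 by (metis insertE empty_iff insertCI)
  have S4: "R a b c h" if "R a b c d" "h \<in> Basis" "h \<notin> {a, b, c}" for a b c d h
    using that new[of d c b a h] R12 R13 R34 by (metis insertE empty_iff insertCI)
  have all: "gen a b c d \<in> U"
    if abcd: "a \<in> Basis" "b \<in> Basis" "c \<in> Basis" "d \<in> Basis" "distinct [a, b, c, d]" for a b c d
  proof -
    have "\<exists>a b c d. R a b c d"
      using B gen by (auto simp: R_def)
    then obtain b1 c1 d1 where 1: "R a b1 c1 d1"
      using S1[OF _ abcd(1)] by blast
    have "b \<noteq> a" "c \<notin> {a, b}" "d \<notin> {a, b, c}"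
      using abcd by auto
    note S = S2[OF 1 abcd(2) this(1)] S3[OF _ abcd(3) this(2)] S4[OF _ abcd(4) this(3)]
    obtain c2 d2 where 2: "R a b c2 d2"
      using S(1) by blast
    obtain d3 where 3: "R a b c d3"
      using S(2)[OF 2] by blast
    have "R a b c d"
      by (rule S(3)[OF 3])
    then show ?thesis
      by (simp add: R_def)
  qed
  txt \<open>Testing against the tensors obtained from \<open>G\<close> by one and two further infinitesimal rotations
    determines the components with a repeated index.\<close>
  show ?thesis
  proof (rule subspace_eqI_orthogonal[OF U(1) subspace_MC_W U(2)])
    show "MC_W \<subseteq> (tensors 4 :: ('a list \<Rightarrow> real) set)"
      using MC_W_MC MC_tensors by blast
    fix Y assume YW: "Y \<in> MC_W" and perp: "\<And>X. X \<in> U \<Longrightarrow> tensor_inner X Y = 0"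
    note ip = tensor_inner_gen[OF MC_W_MC[OF YW]]
    show "Y = 0"
    proof (rule MC_W_eq_zeroI[OF dim YW])
      fix a b c d :: 'a
      assume B: "a \<in> Basis" "b \<in> Basis" "c \<in> Basis" "d \<in> Basis" and dist: "distinct [a, b, c, d]"
      note G = all[OF B dist]
      show "Y [a, c, b, d] + Y [a, d, b, c] = 0"
        using perp[OF G] by (simp add: ip)
      have G1: "gen a b c c - gen a b d d \<in> U"
        using D[OF B(3,4) G] by (simp add: deriv_act_rot_gen34[OF B dist])
      show "Y [a, c, b, c] = Y [a, d, b, d]"
        using perp[OF G1] by (simp add: ip linear_diff[OF tensor_inner_linear_left])
      show "Y [a, c, a, c] - Y [b, c, b, c] = Y [a, d, a, d] - Y [b, d, b, d]"
        using perp[OF D[OF B(1,2) G1]] unfolding deriv_act_rot_gen12[OF B dist]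
        by (simp add: ip linear_diff[OF tensor_inner_linear_left])
    qed
  qed
qed

section \<open>Operators commuting with infinitesimal rotations\<close>

text \<open>Under the curvature symmetries the components at permutations of
  \<open>a, b, c, d\<close> form three classes. Subtracting a multiple of \<open>gen\<close> kills
  one, the weight equation the second, the Bianchi identity the third.\<close>

lemma gen_unique:
  assumes B: "a \<in> Basis" "b \<in> Basis" "c \<in> Basis" "d \<in> Basis" and dist: "distinct [a, b, c, d]"
    and Z: "Z \<in> MC"
    and supp: "\<And>i j k l. i \<in> Basis \<Longrightarrow> j \<in> Basis \<Longrightarrow> k \<in> Basis \<Longrightarrow> l \<in> Basis \<Longrightarrow>
      \<not> {a, b, c, d} \<subseteq> {i, j, k, l} \<Longrightarrow> Z [i, j, k, l] = 0"
    and weight: "deriv_act (rot a b) (deriv_act (rot a b) Z) = - 4 *\<^sub>R Z"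
  shows "\<exists>r. Z = r *\<^sub>R gen a b c d"
proof -
  define r where "r = Z [a, c, b, d]"
  define Y where "Y = Z - r *\<^sub>R gen a b c d"
  have Y: "Y \<in> MC"
    unfolding Y_def by (intro subspace_diff subspace_scale subspace_MC Z gen_MC)
  have "gen a b c d [a, c, b, d] = 1"
    using B dist by (simp add: gen_eq wedge_def inner_Basis)
  then have 1: "Y [a, c, b, d] = 0"
    by (simp add: Y_def r_def fun_vec_simps)
  have "deriv_act (rot a b) (deriv_act (rot a b) Y) = - 4 *\<^sub>R Y"
    by (simp add: Y_def deriv_act_linear_simps weight deriv_act_rot_gen12_twice[OF B dist]
        scaleR_diff_right)
  \<comment> \<open>At these arguments the left side expands to
    \<open>-2 * (Y [a, c, b, d] + Y [b, c, a, d])\<close>.\<close>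
  then have "deriv_act (rot a b) (deriv_act (rot a b) Y) [a, c, b, d] = - 4 * Y [a, c, b, d]"
    by (simp add: fun_vec_simps)
  moreover have "rot a b a = b" "rot a b b = - a" "rot a b c = 0" "rot a b d = 0"
    using B dist by (auto simp: rot_Basis)
  ultimately have 2: "Y [b, c, a, d] = 0"
    using 1 by (simp add: deriv_act_eq rot_zero rot_minus tensors4_simps[OF MC_tensors[OF Y]])
  have 3: "Y [a, b, c, d] = 0"
    using MC_Bianchi[OF Y, of a b c d] MC_swap12[OF Y, of c a b d] 1 2 by linarith
  have syms: "Y [y, x, z, w] = 0 \<and> Y [x, y, w, z] = 0 \<and> Y [y, x, w, z] = 0 \<and>
      Y [z, w, x, y] = 0 \<and> Y [w, z, x, y] = 0 \<and> Y [z, w, y, x] = 0 \<and> Y [w, z, y, x] = 0"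
    if "Y [x, y, z, w] = 0" for x y z w
    using that MC_swap12[OF Y, of y x z w] MC_swap34[OF Y, of x y w z] MC_swap34[OF Y, of y x w z]
      MC_pair[OF Y, of z w x y] MC_pair[OF Y, of w z x y] MC_pair[OF Y, of z w y x]
      MC_pair[OF Y, of w z y x] by linarith
  have "Y = 0"
  proof (rule tensors4_ext_Basis[OF MC_tensors[OF Y] subspace_0[OF subspace_tensors4]])
    fix i j k l :: 'a assume IB: "i \<in> Basis" "j \<in> Basis" "k \<in> Basis" "l \<in> Basis"
    have "Y [i, j, k, l] = 0"
    proof (cases "{a, b, c, d} \<subseteq> {i, j, k, l}")
      case False
      then obtain x where x: "x \<in> {a, b, c, d}" "x \<notin> {i, j, k, l}"
        by blast
      then have "i \<bullet> x = 0" "j \<bullet> x = 0" "k \<bullet> x = 0" "l \<bullet> x = 0"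
        using B IB by (auto simp: inner_not_same_Basis)
      then have "gen a b c d [i, j, k, l] = 0"
        using x(1) by (auto simp: gen_eq wedge_def)
      then show ?thesis
        using supp[OF IB False] by (simp add: Y_def fun_vec_simps)
    next
      case True
      \<comment> \<open>Four arguments covering four distinct vectors are a permutation of
        them.\<close>
      have "card {i, j, k, l} \<le> card {a, b, c, d}"
        using card_length[of "[i, j, k, l]"] dist by simp
      then have eq: "{a, b, c, d} = {i, j, k, l}"
        by (intro card_seteq True) auto
      have "card {a, b, c, d} = 4"
        using dist by simp
      then have "card (set [i, j, k, l]) = length [i, j, k, l]"
        unfolding eq by simp
      then have "distinct [i, j, k, l]"
        by (rule card_distinct)
      moreover have "i \<in> {a, b, c, d}" "j \<in> {a, b, c, d}" "k \<in> {a, b, c, d}" "l \<in> {a, b, c, d}"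
        unfolding eq by auto
      ultimately show ?thesis
        using 1 2 3 syms[OF 1] syms[OF 2] syms[OF 3] by (elim insertE emptyE) simp_all
    qed
    then show "Y [i, j, k, l] = (0 :: 'a list \<Rightarrow> real) [i, j, k, l]"
      by simp
  qed
  then show ?thesis
    by (auto simp: Y_def)
qed

text \<open>If \<open>A\<close> kills all arguments but one, applying it twice can only hit that
  slot, where its square is zero or minus the identity.\<close>

lemma deriv_act_twice_one_slot:
  assumes X: "X \<in> tensors 4" and A0: "A 0 = 0"
    and A: "\<And>x. x \<in> {i, j, k, l} \<Longrightarrow> A x = 0 \<or> A (A x) = - x"
    and three: "A i = 0 \<and> A j = 0 \<and> A k = 0 \<or> A i = 0 \<and> A j = 0 \<and> A l = 0 \<or>
      A i = 0 \<and> A k = 0 \<and> A l = 0 \<or> A j = 0 \<and> A k = 0 \<and> A l = 0"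
  shows "deriv_act A (deriv_act A X) [i, j, k, l] \<in> {0, - X [i, j, k, l]}"
  using three A[of i] A[of j] A[of k] A[of l]
  by (auto simp: deriv_act_eq tensors4_simps[OF X] A0)

text \<open>If \<open>e\<close> occurs among the arguments, then one of the planes \<open>ab\<close> and \<open>cd\<close> contains at most one of
  the remaining three, and on such a component the squared rotation is \<open>0\<close> or \<open>-1\<close> instead of \<open>-4\<close>.\<close>

lemma weight_supp:
  assumes dim: "e \<in> Basis" "e \<notin> {a, b, c, d}"
    and B: "a \<in> Basis" "b \<in> Basis" "c \<in> Basis" "d \<in> Basis" and dist: "distinct [a, b, c, d]"
    and Z: "Z \<in> tensors 4"
    and ab: "deriv_act (rot a b) (deriv_act (rot a b) Z) = - 4 *\<^sub>R Z"
    and cd: "deriv_act (rot c d) (deriv_act (rot c d) Z) = - 4 *\<^sub>R Z"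
    and new: "\<And>x. x \<in> {a, b, c, d} \<Longrightarrow> deriv_act (rot x e) (deriv_act (rot x e) Z) = - Z"
    and I: "i \<in> Basis" "j \<in> Basis" "k \<in> Basis" "l \<in> Basis" and miss: "\<not> {a, b, c, d} \<subseteq> {i, j, k, l}"
  shows "Z [i, j, k, l] = 0"
proof (cases "e \<in> {i, j, k, l}")
  case True
  have rot0: "rot x y z = 0 \<or> rot x y (rot x y z) = - z"
    if "x \<in> Basis" "y \<in> Basis" "x \<noteq> y" "z \<in> Basis" for x y z :: 'a
    using that rot_Basis(3)[of x y z] rot_Basis(1,2)[of x y]
    by (cases "z = x \<or> z = y") (auto simp: rot_minus)
  have one: "Z [i, j, k, l] = 0"
    if xy: "x \<in> Basis" "y \<in> Basis" "x \<noteq> y"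
      and w: "deriv_act (rot x y) (deriv_act (rot x y) Z) = - 4 *\<^sub>R Z"
      and three: "rot x y i = 0 \<and> rot x y j = 0 \<and> rot x y k = 0 \<or>
        rot x y i = 0 \<and> rot x y j = 0 \<and> rot x y l = 0 \<or>
        rot x y i = 0 \<and> rot x y k = 0 \<and> rot x y l = 0 \<or>
        rot x y j = 0 \<and> rot x y k = 0 \<and> rot x y l = 0" for x y
  proof -
    have "deriv_act (rot x y) (deriv_act (rot x y) Z) [i, j, k, l] \<in> {0, - Z [i, j, k, l]}"
      using rot0[OF xy] I by (intro deriv_act_twice_one_slot[OF Z rot_zero _ three]) auto
    then show ?thesis
      unfolding w fun_vec_simps by auto
  qed
  \<comment> \<open>The planes share no basis vector, so each argument is killed by one of the two
    rotations, and \<open>e\<close> by both.\<close>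
  have z: "rot a b z = 0 \<or> rot c d z = 0" if "z \<in> Basis" for z
    using that B dist rot_Basis(3)[of a b z] rot_Basis(3)[of c d z] by auto
  have "rot a b e = 0" "rot c d e = 0"
    using B dist dim by (auto simp: rot_Basis)
  then show ?thesis
    using True z[OF I(1)] z[OF I(2)] z[OF I(3)] z[OF I(4)] one[OF B(1,2) _ ab] one[OF B(3,4) _ cd] dist
    by auto
next
  case False
  \<comment> \<open>If \<open>e\<close> does not occur, the rotation in the plane of
    \<open>e\<close> and a missing \<open>x\<close> kills all arguments, although \<open>Z\<close>
    has weight one under it.\<close>
  obtain x where x: "x \<in> {a, b, c, d}" "x \<notin> {i, j, k, l}"
    using miss by blast
  then have "x \<in> Basis" "x \<noteq> e"
    using B dim by auto
  then have "rot x e i = 0" "rot x e j = 0" "rot x e k = 0" "rot x e l = 0"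
    using x False I dim by (auto intro!: rot_Basis(3))
  then have "deriv_act (rot x e) (deriv_act (rot x e) Z) [i, j, k, l] = 0"
    by (simp add: deriv_act_eq rot_zero tensors4_simps[OF Z])
  then show ?thesis
    unfolding new[OF x(1)] fun_vec_simps by simp
qed

text \<open>Each of the four vectors enters every term exactly once, so reflecting one of them flips
  the sign.\<close>

lemma mirror_act_gen:
  assumes B: "a \<in> Basis" "b \<in> Basis" "c \<in> Basis" "d \<in> Basis" and dist: "distinct [a, b, c, d]"
    and e: "e \<in> {a, b, c, d}"
  shows "mirror_act e (gen a b c d) = - gen a b c d"
proof (rule tensors4_ext_Basis)
  show "mirror_act e (gen a b c d) \<in> tensors 4" "- gen a b c d \<in> tensors 4"
    by (intro mirror_act_tensors subspace_neg[OF subspace_tensors4] MC_tensors gen_MC)+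
  have eB: "e \<in> Basis"
    using B e by auto
  have m: "mirror e x \<bullet> y = (if y = e then - (x \<bullet> y) else x \<bullet> y)" if "y \<in> Basis" for x y
    using that eB by (auto simp: mirror_def inner_diff_left inner_Basis)
  show "mirror_act e (gen a b c d) [x, y, z, w] = (- gen a b c d) [x, y, z, w]" for x y z w
    using e dist by (auto simp: mirror_act_eq gen_eq wedge_def m B fun_vec_simps algebra_simps)
qed

lemma obtain_four_Basis:
  assumes dim: "DIM('a::euclidean_space) \<ge> 4"
  obtains a b c d :: "'a::euclidean_space" where "a \<in> Basis" "b \<in> Basis" "c \<in> Basis" "d \<in> Basis" "distinct [a, b, c, d]"
proof -
  obtain a :: 'a where a: "a \<in> Basis"
    using nonempty_Basis by blast
  obtain b :: 'a where b: "b \<in> Basis" "b \<notin> {a}"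
    by (rule obtain_Basis_not_in[of "{a}"]) (use dim in \<open>auto simp: card_insert_if\<close>)
  obtain c :: 'a where c: "c \<in> Basis" "c \<notin> {a, b}"
    by (rule obtain_Basis_not_in[of "{a, b}"]) (use dim in \<open>auto simp: card_insert_if\<close>)
  obtain d :: 'a where d: "d \<in> Basis" "d \<notin> {a, b, c}"
    by (rule obtain_Basis_not_in[of "{a, b, c}"]) (use dim in \<open>auto simp: card_insert_if\<close>)
  show thesis
    using that[of a b c d] a b c d by auto
qed

text \<open>In dimension four the rotations preserve the selfdual and anti-selfdual Weyl tensors
  separately; reflections exchange the two parts, which is why commuting with them is demanded
  there.\<close>

lemma commuting_operator_scalar:
  fixes T :: "('a::euclidean_space list \<Rightarrow> real) \<Rightarrow> 'a list \<Rightarrow> real"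
  assumes dim: "DIM('a) \<ge> 4" and lin: "linear T" and TW: "\<And>X. X \<in> MC_W \<Longrightarrow> T X \<in> MC_W"
    and D: "\<And>x y X. x \<in> Basis \<Longrightarrow> y \<in> Basis \<Longrightarrow> X \<in> MC_W \<Longrightarrow>
      T (deriv_act (rot x y) X) = deriv_act (rot x y) (T X)"
    and cases: "DIM('a) > 4 \<or>
      (\<forall>e\<in>Basis. \<forall>X\<in>MC_W. T (mirror_act e X) = mirror_act e (T X))"
  shows "\<exists>r. \<forall>X\<in>MC_W. T X = r *\<^sub>R X"
proof -
  obtain a b c d :: 'a where B: "a \<in> Basis" "b \<in> Basis" "c \<in> Basis" "d \<in> Basis"
    and dist: "distinct [a, b, c, d]"
    using obtain_four_Basis[OF dim] by metis
  let ?G = "gen a b c d"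
  define Z where "Z = T ?G"
  note G = gen_MC_W[OF B dist]
  have Z: "Z \<in> MC"
    unfolding Z_def by (intro MC_W_MC TW G)
  have DD: "deriv_act (rot x y) (deriv_act (rot x y) Z) = T (deriv_act (rot x y) (deriv_act (rot x y) ?G))"
    if "x \<in> Basis" "y \<in> Basis" for x y
    unfolding Z_def using that G D deriv_act_MC_W[OF skew_rot] by metis
  have ab: "deriv_act (rot a b) (deriv_act (rot a b) Z) = - 4 *\<^sub>R Z"
    unfolding DD[OF B(1,2)] deriv_act_rot_gen12_twice[OF B dist]
    by (simp only: linear_scale[OF lin] Z_def)
  have cd: "deriv_act (rot c d) (deriv_act (rot c d) Z) = - 4 *\<^sub>R Z"
  proof -
    have "deriv_act (rot c d) (deriv_act (rot c d) ?G) = - 4 *\<^sub>R ?G"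
      using deriv_act_rot_gen12_twice[of c d a b] B dist by (auto simp: gen_swap_pairs[of c d a b])
    then show ?thesis
      unfolding DD[OF B(3,4)] by (simp only: linear_scale[OF lin] Z_def)
  qed
  have supp: "Z [i, j, k, l] = 0"
    if I: "i \<in> Basis" "j \<in> Basis" "k \<in> Basis" "l \<in> Basis" and miss: "\<not> {a, b, c, d} \<subseteq> {i, j, k, l}"
    for i j k l
    using cases
  proof
    assume "DIM('a) > 4"
    obtain e :: 'a where e: "e \<in> Basis" "e \<notin> {a, b, c, d}"
      by (rule obtain_Basis_not_in[of "{a, b, c, d}"]) (use dist \<open>DIM('a) > 4\<close> in auto)
    have "deriv_act (rot x e) (deriv_act (rot x e) ?G) = - ?G" if "x \<in> {a, b, c, d}" for x
    proof -
      have "?G = gen b a c d" "?G = gen c d a b" "?G = gen d c a b"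
        by (simp_all add: gen_swap12[of b a] gen_swap12[of d c] gen_swap_pairs[of c d a b])
      then show ?thesis
        using that deriv_act_rot_gen_new_twice[of a b c d e] deriv_act_rot_gen_new_twice[of b a c d e]
          deriv_act_rot_gen_new_twice[of c d a b e] deriv_act_rot_gen_new_twice[of d c a b e] B dist e
        by auto
    qed
    then have "deriv_act (rot x e) (deriv_act (rot x e) Z) = - Z" if "x \<in> {a, b, c, d}" for x
      using DD[of x e] that B e linear_neg[OF lin] by (auto simp: Z_def)
    then show ?thesis
      by (rule weight_supp[OF e B dist MC_tensors[OF Z] ab cd _ I miss])
  next
    assume m: "\<forall>e\<in>Basis. \<forall>X\<in>MC_W. T (mirror_act e X) = mirror_act e (T X)"
    \<comment> \<open>The reflection fixes all four arguments but changes the sign of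
      \<open>Z\<close>.\<close>
    obtain e where e: "e \<in> {a, b, c, d}" "e \<notin> {i, j, k, l}"
      using miss by blast
    then have eB: "e \<in> Basis"
      using B by auto
    have "mirror_act e Z = - Z"
    proof -
      have "mirror_act e Z = T (mirror_act e ?G)"
        using m eB G by (simp add: Z_def)
      then show ?thesis
        by (simp add: mirror_act_gen[OF B dist e(1)] linear_neg[OF lin] Z_def)
    qed
    then have "mirror_act e Z [i, j, k, l] = - Z [i, j, k, l]"
      by (simp add: fun_vec_simps)
    then show ?thesis
      using e I by (auto simp: mirror_act_eq mirror_Basis eB)
  qed
  obtain r where r: "Z = r *\<^sub>R ?G"
    using gen_unique[OF B dist Z supp ab] by blast
  \<comment> \<open>The eigenspace of \<open>r\<close> is invariant under rotations and contains the
    generator, so it is everything.\<close>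
  define U where "U = {X \<in> MC_W. T X = r *\<^sub>R X}"
  have "U = MC_W"
  proof (rule gen_orbit_span[OF dim _ _ _ B dist])
    show "subspace U"
      using subspace_MC_W
      by (auto simp: U_def subspace_def linear_0[OF lin] linear_add[OF lin] linear_scale[OF lin]
          scaleR_add_right mult.commute)
    show "deriv_act (rot x y) X \<in> U" if "x \<in> Basis" "y \<in> Basis" "X \<in> U" for x y X
      using that by (auto simp: U_def D deriv_act_MC_W[OF skew_rot] deriv_act_linear_simps)
    show "?G \<in> U"
      using G r by (simp add: U_def Z_def)
  qed (auto simp: U_def)
  then show ?thesis
    by (auto simp: U_def)
qed

section \<open>The Killing form\<close>

text \<open>At the arguments \<open>[a, b, a, b]\<close> only the contractions of slots (1,4) and
  (2,3) survive, and both give the sum of the squares of \<open>h\<close>, the symmetric product of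
  \<open>c\<close> and \<open>d\<close>.\<close>

lemma curv_mult_gen_neq_zero:
  assumes B: "a \<in> Basis" "b \<in> Basis" "c \<in> Basis" "d \<in> Basis" and dist: "distinct [a, b, c, d]"
  shows "curv_mult (gen a b c d) (gen a b c d) \<noteq> 0"
proof -
  let ?G = "gen a b c d"
  define h where "h p q = (p \<bullet> c) * (q \<bullet> d) + (p \<bullet> d) * (q \<bullet> c)" for p q
  have ip: "a \<bullet> a = 1" "a \<bullet> b = 0" "a \<bullet> c = 0" "a \<bullet> d = 0" "b \<bullet> a = 0" "b \<bullet> b = 1" "b \<bullet> c = 0" "b \<bullet> d = 0"
    using B dist by (auto simp: inner_Basis)
  note simps = gen_eq wedge_def ip
  have z: "?G [p, q, a, b] = 0" "?G [a, b, p, q] = 0" "?G [p, b, q, b] = 0" "?G [a, p, a, q] = 0" for p q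
    by (simp_all add: simps)
  have nz: "?G [p, a, b, q] = - h p q" "?G [p, b, a, q] = - h p q" "?G [a, p, q, b] = - h p q" for p q
    by (simp_all add: simps h_def)
  have "curv_mult ?G ?G [a, b, a, b] = (\<Sum>p\<in>Basis. \<Sum>q\<in>Basis. h p q * h p q)"
    by (simp add: curv_mult_eq[OF gen_MC] contr_zero z) (simp add: contr_def nz)
  moreover have "(\<Sum>p\<in>Basis. \<Sum>q\<in>Basis. h p q * h p q) > 0"
  proof (rule sum_pos2[OF finite_Basis B(3)])
    have "h c d = 1"
      using B dist by (simp add: h_def inner_Basis)
    then show "(\<Sum>q\<in>Basis. h c q * h c q) > 0"
      by (intro sum_pos2[OF finite_Basis B(4)]) auto
  qed (simp add: sum_nonneg)
  ultimately show ?thesis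
    by auto
qed

text \<open>The Leibniz rule read as \<open>L(DX) = [D, L(X)]\<close>, the form in which it enters
  traces.\<close>

lemma deriv_act_commutator:
  assumes A: "skew A" and X: "X \<in> MC_W" and Z: "Z \<in> MC_W"
  shows "curv_mult (deriv_act A X) Z = deriv_act A (curv_mult X Z) - curv_mult X (deriv_act A Z)"
  using curv_mult_deriv_act[OF A MC_W_MC[OF X] MC_tensors[OF MC_W_MC[OF Z]]] by simp

context
  fixes E :: "('a::euclidean_space list \<Rightarrow> real) set"
  assumes E: "orthonormal_basis tensor_inner MC_W E"
begin

lemmas trace_MC_W = trace_on_orthonormal_basis[OF tensor_inner_product E subspace_MC_W]

lemma trace_MC_W_commute:
  assumes "linear f" "\<And>X. X \<in> MC_W \<Longrightarrow> f X \<in> MC_W" "linear g" "\<And>X. X \<in> MC_W \<Longrightarrow> g X \<in> MC_W"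
  shows "(\<Sum>e\<in>E. tensor_inner (f (g e)) e) = (\<Sum>e\<in>E. tensor_inner (g (f e)) e)"
  using trace_on_commute[OF tensor_inner_product E subspace_MC_W assms]
    trace_MC_W[of "f \<circ> g"] trace_MC_W[of "g \<circ> f"] assms by (simp add: linear_compose)

lemma E_MC_W: "e \<in> E \<Longrightarrow> e \<in> MC_W"
  using E by (auto simp: orthonormal_basis_def)

lemma E_expansion: "X \<in> MC_W \<Longrightarrow> X = (\<Sum>e\<in>E. tensor_inner X e *\<^sub>R e)"
  using E by (auto simp: orthonormal_basis_def)

text \<open>The Killing form as an explicit sum over \<open>E\<close>, bilinear without restricting
  the arguments to \<open>MC_W\<close>.\<close>

definition ktrace :: "('a list \<Rightarrow> real) \<Rightarrow> ('a list \<Rightarrow> real) \<Rightarrow> real"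
  where "ktrace X Y = (\<Sum>e\<in>E. tensor_inner (curv_mult X (curv_mult Y e)) e)"

lemma killing_form_eq_ktrace:
  assumes "X \<in> MC_W" "Y \<in> MC_W"
  shows "killing_form MC_W curv_mult X Y = ktrace X Y"
  unfolding killing_form_def ktrace_def
  by (subst trace_MC_W) (auto intro: linear_compose linear_curv_mult curv_mult_MC_W assms)

lemma exact_MC_W:
  assumes dim: "DIM('a) \<ge> 4" and X: "X \<in> MC_W"
  shows "(\<Sum>e\<in>E. tensor_inner (curv_mult X e) e) = 0"
proof -
  define t where "t X = (\<Sum>e\<in>E. tensor_inner (curv_mult X e) e)" for X
  have lin: "linear t"
    unfolding t_def
    by (intro linear_compose_sum ballI
        linear_compose[OF linear_curv_mult_left tensor_inner_linear_left, unfolded o_def])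
  have t0: "t (deriv_act (rot x y) X) = 0" if "X \<in> MC_W" for x y X
  proof -
    have "t (deriv_act (rot x y) X) =
        (\<Sum>e\<in>E. tensor_inner (deriv_act (rot x y) (curv_mult X e)) e) -
        (\<Sum>e\<in>E. tensor_inner (curv_mult X (deriv_act (rot x y) e)) e)"
      by (simp add: t_def deriv_act_commutator[OF skew_rot that E_MC_W]
          linear_diff[OF tensor_inner_linear_left] sum_subtractf)
    also have "\<dots> = 0"
      by (subst trace_MC_W_commute)
        (auto intro: linear_deriv_act linear_curv_mult deriv_act_MC_W skew_rot curv_mult_MC_W that)
    finally show ?thesis .
  qed
  obtain a b c d :: 'a where B: "a \<in> Basis" "b \<in> Basis" "c \<in> Basis" "d \<in> Basis"
    and dist: "distinct [a, b, c, d]"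
    using obtain_four_Basis[OF dim] by metis
  define U where "U = {X \<in> MC_W. t X = 0}"
  have "U = MC_W"
  proof (rule gen_orbit_span[OF dim _ _ _ B dist])
    show "subspace U"
      using subspace_MC_W
      by (auto simp: U_def subspace_def linear_0[OF lin] linear_add[OF lin] linear_scale[OF lin])
    show "deriv_act (rot x y) X \<in> U" if "X \<in> U" for x y X
      using that by (auto simp: U_def t0 deriv_act_MC_W[OF skew_rot])
    \<comment> \<open>The generator is itself an infinitesimal rotation of a Weyl tensor, up to the
      factor -4, so its trace is that of a commutator.\<close>
    have "t (- 4 *\<^sub>R gen a b c d) = 0"
      unfolding deriv_act_rot_gen12_twice[OF B dist, symmetric]
      by (intro t0 deriv_act_MC_W[OF skew_rot] gen_MC_W B dist)
    then show "gen a b c d \<in> U"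
      using gen_MC_W[OF B dist] by (simp add: U_def linear_scale[OF lin] linear_neg[OF lin])
  qed (auto simp: U_def)
  then show ?thesis
    using X by (auto simp: U_def t_def)
qed

lemma ktrace_linear: "linear (\<lambda>X. ktrace X Y)" "linear (ktrace X)"
  unfolding ktrace_def
  by (intro linear_compose_sum ballI
      linear_compose[OF linear_curv_mult_left tensor_inner_linear_left, unfolded o_def]
      linear_compose[OF linear_compose[OF linear_curv_mult_left linear_curv_mult]
        tensor_inner_linear_left, unfolded o_def])+

text \<open>Writing both sides with commutators, the terms with \<open>D\<close> in the middle
  cancel and those with \<open>D\<close> outside have equal trace by cyclicity.\<close>

lemma ktrace_deriv_act:
  assumes A: "skew A" and X: "X \<in> MC_W" and Y: "Y \<in> MC_W"
  shows "ktrace (deriv_act A X) Y = - ktrace X (deriv_act A Y)"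
proof -
  let ?D = "deriv_act A" and ?t = "\<lambda>f. \<Sum>e\<in>E. tensor_inner (f e) e"
  have 1: "ktrace (?D X) Y = ?t (\<lambda>e. ?D (curv_mult X (curv_mult Y e))) -
      ?t (\<lambda>e. curv_mult X (?D (curv_mult Y e)))"
    by (simp add: ktrace_def deriv_act_commutator[OF A X] curv_mult_MC_W Y E_MC_W
        linear_diff[OF tensor_inner_linear_left] sum_subtractf)
  have 2: "ktrace X (?D Y) = ?t (\<lambda>e. curv_mult X (?D (curv_mult Y e))) -
      ?t (\<lambda>e. curv_mult X (curv_mult Y (?D e)))"
    by (simp add: ktrace_def deriv_act_commutator[OF A Y] E_MC_W linear_diff[OF linear_curv_mult]
        linear_diff[OF tensor_inner_linear_left] sum_subtractf)
  have 3: "?t (\<lambda>e. ?D (curv_mult X (curv_mult Y e))) = ?t (\<lambda>e. curv_mult X (curv_mult Y (?D e)))"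
    by (rule trace_MC_W_commute[of ?D "\<lambda>e. curv_mult X (curv_mult Y e)"])
      (auto intro: linear_deriv_act linear_compose[OF linear_curv_mult linear_curv_mult, unfolded o_def]
        deriv_act_MC_W A curv_mult_MC_W X Y)
  show ?thesis
    unfolding 1 2 3 by simp
qed

text \<open>The reflection \<open>s\<close> is an involutive automorphism, so
  \<open>L(sX) = s L(X) s\<close>, and cyclicity moves the outer \<open>s\<close>.\<close>

lemma ktrace_mirror_act:
  assumes x: "x \<in> Basis" and X: "X \<in> MC_W" and Y: "Y \<in> MC_W"
  shows "ktrace (mirror_act x X) Y = ktrace X (mirror_act x Y)"
proof -
  let ?s = "mirror_act x" and ?t = "\<lambda>f. \<Sum>e\<in>E. tensor_inner (f e) e"
  have s: "curv_mult (?s X) Z = ?s (curv_mult X (?s Z))" if "X \<in> MC_W" "Z \<in> MC_W" for X Z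
    using curv_mult_mirror_act[OF x MC_W_MC[OF that(1)] MC_W_MC[OF mirror_act_MC_W[OF x that(2)]]]
    by (simp add: mirror_act_mirror_act x)
  have "ktrace (?s X) Y = ?t (\<lambda>e. ?s (curv_mult X (?s (curv_mult Y e))))"
    by (simp add: ktrace_def s X Y E_MC_W curv_mult_MC_W)
  also have "\<dots> = ?t (\<lambda>e. curv_mult X (?s (curv_mult Y (?s e))))"
    by (rule trace_MC_W_commute[of ?s "\<lambda>e. curv_mult X (?s (curv_mult Y e))"])
      (auto intro: linear_mirror_act mirror_act_MC_W x curv_mult_MC_W X Y
        linear_compose[OF linear_curv_mult linear_compose[OF linear_mirror_act linear_curv_mult],
          unfolded o_def])
  also have "\<dots> = ktrace X (?s Y)"
    by (simp add: ktrace_def s X Y E_MC_W)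
  finally show ?thesis .
qed

lemma ktrace_scalar:
  assumes dim: "DIM('a) \<ge> 4"
  shows "\<exists>r. r \<noteq> 0 \<and> (\<forall>X\<in>MC_W. \<forall>Y\<in>MC_W. ktrace X Y = r * tensor_inner X Y)"
proof -
  \<comment> \<open>The operator representing \<open>ktrace\<close> with respect to the inner
    product.\<close>
  define T where "T X = (\<Sum>e\<in>E. ktrace X e *\<^sub>R e)" for X
  have lin: "linear T"
    by (rule linearI) (simp_all add: T_def linear_add[OF ktrace_linear(1)]
        linear_scale[OF ktrace_linear(1)] scaleR_add_left sum.distrib scaleR_sum_right)
  have TW: "T X \<in> MC_W" for X
    unfolding T_def by (intro subspace_sum subspace_scale subspace_MC_W E_MC_W)
  have ipT: "tensor_inner (T X) Y = ktrace X Y" if "Y \<in> MC_W" for X Y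
  proof -
    have "ktrace X Y = ktrace X (\<Sum>e\<in>E. tensor_inner Y e *\<^sub>R e)"
      using E_expansion[OF that] by simp
    also have "\<dots> = tensor_inner (T X) Y"
      unfolding linear_combination[OF ktrace_linear(2)] T_def ip_sum_left[OF tensor_inner_product]
      by (simp add: tensor_inner_commute[of Y] mult.commute)
    finally show ?thesis ..
  qed
  have eqI: "U = V" if U: "U \<in> MC_W" and V: "V \<in> MC_W"
    and eq: "\<And>Y. Y \<in> MC_W \<Longrightarrow> tensor_inner U Y = tensor_inner V Y" for U V :: "'a list \<Rightarrow> real"
  proof -
    have "U = (\<Sum>e\<in>E. tensor_inner U e *\<^sub>R e)"
      by (rule E_expansion[OF U])
    also have "\<dots> = (\<Sum>e\<in>E. tensor_inner V e *\<^sub>R e)"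
      by (simp add: eq E_MC_W)
    also have "\<dots> = V"
      by (rule E_expansion[OF V, symmetric])
    finally show ?thesis .
  qed
  have "\<exists>r. \<forall>X\<in>MC_W. T X = r *\<^sub>R X"
  proof (rule commuting_operator_scalar[OF dim lin TW])
    show "T (deriv_act (rot x y) X) = deriv_act (rot x y) (T X)" if X: "X \<in> MC_W" for x y X
    proof (rule eqI)
      fix Y :: "'a list \<Rightarrow> real" assume Y: "Y \<in> MC_W"
      show "tensor_inner (T (deriv_act (rot x y) X)) Y = tensor_inner (deriv_act (rot x y) (T X)) Y"
        using tensor_inner_deriv_act[OF skew_rot MC_tensors[OF MC_W_MC[OF TW]] MC_tensors[OF MC_W_MC[OF Y]]]
        by (simp add: ipT Y ktrace_deriv_act[OF skew_rot X Y] deriv_act_MC_W[OF skew_rot Y])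
    qed (intro TW deriv_act_MC_W[OF skew_rot])+
    have "T (mirror_act e X) = mirror_act e (T X)" if e: "e \<in> Basis" and X: "X \<in> MC_W" for e X
    proof (rule eqI)
      fix Y :: "'a list \<Rightarrow> real" assume Y: "Y \<in> MC_W"
      show "tensor_inner (T (mirror_act e X)) Y = tensor_inner (mirror_act e (T X)) Y"
        using tensor_inner_mirror_act[OF e MC_tensors[OF MC_W_MC[OF TW]] MC_tensors[OF MC_W_MC[OF Y]]]
        by (simp add: ipT Y ktrace_mirror_act[OF e X Y] mirror_act_MC_W[OF e Y])
    qed (intro TW mirror_act_MC_W[OF e])+
    then show "DIM('a) > 4 \<or> (\<forall>e\<in>Basis. \<forall>X\<in>MC_W. T (mirror_act e X) = mirror_act e (T X))"
      by blast
  qed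
  then obtain r where r: "T X = r *\<^sub>R X" if "X \<in> MC_W" for X
    by blast
  have k: "ktrace X Y = r * tensor_inner X Y" if "X \<in> MC_W" "Y \<in> MC_W" for X Y
    using ipT[OF that(2), of X] r[OF that(1)] by (simp add: linear_scale[OF tensor_inner_linear_left])
  obtain a b c d :: 'a where B: "a \<in> Basis" "b \<in> Basis" "c \<in> Basis" "d \<in> Basis"
    and dist: "distinct [a, b, c, d]"
    using obtain_four_Basis[OF dim] by metis
  let ?G = "gen a b c d"
  note G = gen_MC_W[OF B dist]
  have "r \<noteq> 0"
  proof
    assume "r = 0"
    have nonneg: "tensor_inner X X \<ge> 0" for X :: "'a list \<Rightarrow> real"
      unfolding tensor_inner_def by (intro sum_nonneg) auto
    have "0 = ktrace ?G ?G"
      using k[OF G G] \<open>r = 0\<close> by simp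
    \<comment> \<open>Self-adjointness makes \<open>ktrace ?G ?G\<close> a sum of squared norms;
      were it zero, \<open>?G\<close> would annihilate all of \<open>E\<close> and hence
      itself.\<close>
    also have "\<dots> = (\<Sum>e\<in>E. tensor_inner (curv_mult ?G e) (curv_mult ?G e))"
      by (simp add: ktrace_def curv_mult_self_adjoint[OF gen_MC, of _ _ _ _ "curv_mult _ _"])
    finally have "tensor_inner (curv_mult ?G e) (curv_mult ?G e) = 0" if "e \<in> E" for e
      using that E nonneg by (simp add: sum_nonneg_eq_0_iff orthonormal_basis_def)
    then have "curv_mult ?G e = 0" if "e \<in> E" for e
      using that tensor_inner_pos[OF MC_tensors[OF MC_W_MC[OF curv_mult_MC_W[OF G E_MC_W]]]] by force
    then have "curv_mult ?G (\<Sum>e\<in>E. tensor_inner ?G e *\<^sub>R e) = 0"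
      unfolding linear_combination[OF linear_curv_mult] by simp
    then show False
      using curv_mult_gen_neq_zero[OF B dist] E_expansion[OF G] by simp
  qed
  then show ?thesis
    using k by blast
qed

end


section \<open>Ideals\<close>

lemma simple_MC_W:
  assumes dim: "DIM('a::euclidean_space) > 4"
  shows "simple_algebra (MC_W :: ('a list \<Rightarrow> real) set) curv_mult"
  unfolding simple_algebra_def
proof (intro conjI allI impI)
  let ?W = "MC_W :: ('a list \<Rightarrow> real) set"
  have dim4: "DIM('a) \<ge> 4"
    using dim by simp
  obtain a b c d :: 'a where B: "a \<in> Basis" "b \<in> Basis" "c \<in> Basis" "d \<in> Basis"
    and dist: "distinct [a, b, c, d]"
    using obtain_four_Basis[OF dim4] by metis
  show "\<exists>X\<in>?W. \<exists>Y\<in>?W. curv_mult X Y \<noteq> 0"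
    using gen_MC_W[OF B dist] curv_mult_gen_neq_zero[OF B dist] by blast
  fix I assume "algebra_ideal I ?W curv_mult"
  then have I: "subspace I" "I \<subseteq> ?W" and ideal: "\<And>X Y. X \<in> ?W \<Longrightarrow> Y \<in> I \<Longrightarrow> curv_mult X Y \<in> I"
    by (auto simp: algebra_ideal_def)
  have WT: "X \<in> tensors 4" if "X \<in> ?W" for X
    using that by (intro MC_tensors MC_W_MC)
  have IT: "I \<subseteq> tensors 4"
    using I(2) WT by blast
  obtain P where P: "linear P" "\<And>X. P X \<in> I" "\<And>X. X \<in> I \<Longrightarrow> P X = X"
    and perp: "\<And>X Y. Y \<in> I \<Longrightarrow> tensor_inner (X - P X) Y = 0"
    using orthogonal_decomposition[OF I(1) IT] by blast
  obtain E where E: "orthonormal_basis tensor_inner ?W E"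
    using orthonormal_basis_exists[OF subspace_MC_W] WT by blast
  obtain r where r: "r \<noteq> 0" "\<And>X Y. X \<in> ?W \<Longrightarrow> Y \<in> ?W \<Longrightarrow> ktrace E X Y = r * tensor_inner X Y"
    using ktrace_scalar[OF E dim4] by blast
  \<comment> \<open>The orthogonal complement of the ideal within the Weyl tensors.\<close>
  define J where "J = {Y \<in> ?W. \<forall>X\<in>I. tensor_inner X Y = 0}"
  have zero: "X = 0" if "X \<in> ?W" "tensor_inner X X = 0" for X
    using tensor_inner_pos[OF WT[OF that(1)]] that(2) by force
  \<comment> \<open>By self-adjointness the squared norm of the product is the inner product of
    \<open>X * (X * Y)\<close>, which lies in \<open>I\<close>, with \<open>Y\<close>.\<close>
  have IJ: "curv_mult X Y = 0" if X: "X \<in> I" and Y: "Y \<in> J" for X Y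
  proof -
    have XW: "X \<in> ?W" and YW: "Y \<in> ?W"
      using X Y I by (auto simp: J_def)
    have "curv_mult Y X \<in> I"
      by (rule ideal[OF YW X])
    moreover have "curv_mult X Y = curv_mult Y X"
      by (rule curv_mult_commute[OF MC_W_MC[OF XW] MC_W_MC[OF YW]])
    ultimately have "curv_mult X (curv_mult X Y) \<in> I" "curv_mult X Y \<in> ?W"
      using ideal[OF XW] I by auto
    then have "tensor_inner (curv_mult X (curv_mult X Y)) Y = 0"
      using Y by (auto simp: J_def)
    then show ?thesis
      using zero[OF \<open>curv_mult X Y \<in> ?W\<close>] by (simp add: curv_mult_self_adjoint[OF MC_W_MC[OF XW]])
  qed
  \<comment> \<open>Self-adjointness makes the complement an ideal as well.\<close>
  have JW: "curv_mult X Y \<in> J" if X: "X \<in> ?W" and Y: "Y \<in> J" for X Y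
    unfolding J_def
  proof (intro CollectI conjI ballI)
    show "curv_mult X Y \<in> ?W"
      using X Y by (auto simp: J_def intro: curv_mult_MC_W)
    fix Z assume "Z \<in> I"
    then show "tensor_inner Z (curv_mult X Y) = 0"
      using Y ideal[OF X] by (simp add: J_def flip: curv_mult_self_adjoint[OF MC_W_MC[OF X]])
  qed
  have DI: "deriv_act (rot x y) X \<in> I" if X: "X \<in> I" for x y X
  proof -
    let ?D = "deriv_act (rot x y)"
    have XW: "X \<in> ?W"
      using X I by blast
    note DW = deriv_act_MC_W[OF skew_rot, of _ x y]
    have "tensor_inner (?D X) Y = 0" if Y: "Y \<in> J" for Y
    proof -
      have YW: "Y \<in> ?W"
        using Y by (simp add: J_def)
      \<comment> \<open>\<open>Y * e\<close> lies in \<open>J\<close> and \<open>X * e\<close> in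
        \<open>I\<close>, so both compositions of the multiplications by \<open>X\<close> and
        \<open>Y\<close> vanish.\<close>
      have "curv_mult X (curv_mult Y e) = 0" "curv_mult Y (curv_mult X e) = 0" if "e \<in> ?W" for e
        using IJ[OF X JW[OF that Y]] IJ[OF ideal[OF that X] Y] that XW YW
          curv_mult_commute[OF MC_W_MC[OF YW] MC_W_MC[OF that]]
          curv_mult_commute[OF MC_W_MC[OF XW] MC_W_MC[OF that]]
          curv_mult_commute[OF MC_W_MC[OF YW] MC_W_MC[OF curv_mult_MC_W[OF that XW]]] by auto
      note z = this
      have "ktrace E (?D X) Y = - (\<Sum>e\<in>E. tensor_inner (curv_mult X (?D (curv_mult Y e))) e)"
        by (simp add: ktrace_def[OF E] deriv_act_commutator[OF skew_rot XW curv_mult_MC_W[OF YW]]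
            E_MC_W[OF E] z deriv_act_linear_simps linear_neg[OF tensor_inner_linear_left] sum_negf)
      also have "(\<Sum>e\<in>E. tensor_inner (curv_mult X (?D (curv_mult Y e))) e) =
          (\<Sum>e\<in>E. tensor_inner (?D (curv_mult Y (curv_mult X e))) e)"
        by (rule trace_MC_W_commute[OF E, of "curv_mult X" "\<lambda>e. ?D (curv_mult Y e)"])
          (auto intro: linear_curv_mult curv_mult_MC_W XW YW DW
            linear_compose[OF linear_curv_mult linear_deriv_act, unfolded o_def])
      also have "\<dots> = 0"
        by (simp add: z E_MC_W[OF E] deriv_act_linear_simps linear_0[OF tensor_inner_linear_left])
      finally show ?thesis
        using r(1) r(2)[OF DW[OF XW] YW] by simp
    qed
    \<comment> \<open>The part of \<open>?D X\<close> in \<open>J\<close> is orthogonal to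
      \<open>?D X\<close>, as just shown, and to its part in \<open>I\<close>; so it is orthogonal
      to itself.\<close>
    moreover have "?D X - P (?D X) \<in> J"
      using perp[of _ "?D X"] I DW[OF XW] P(2)[of "?D X"] subspace_diff[OF subspace_MC_W]
      by (auto simp: J_def tensor_inner_commute[of _ "?D X - P (?D X)"])
    ultimately have "tensor_inner (?D X - P (?D X)) (?D X - P (?D X)) = 0"
      using perp[OF P(2)[of "?D X"], of "?D X"]
      by (simp add: linear_diff[OF tensor_inner_linear_left] J_def P(2))
    then have "?D X - P (?D X) = 0"
      using \<open>?D X - P (?D X) \<in> J\<close> by (intro zero) (auto simp: J_def)
    then show ?thesis
      using P(2)[of "?D X"] by simp
  qed
  have PJ: "P Y = 0" if "Y \<in> J" for Y
  proof (rule zero)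
    show "P Y \<in> ?W"
      using P(2) I by blast
    have "tensor_inner (Y - P Y) (P Y) = 0" "tensor_inner (P Y) Y = 0"
      using perp[OF P(2)] that P(2) by (auto simp: J_def)
    then show "tensor_inner (P Y) (P Y) = 0"
      by (simp add: linear_diff[OF tensor_inner_linear_left] tensor_inner_commute[of Y])
  qed
  have "\<exists>s. \<forall>X\<in>?W. P X = s *\<^sub>R X"
  proof (rule commuting_operator_scalar[OF dim4 P(1)])
    show "P X \<in> ?W" for X
      using P(2) I by blast
    fix x y :: 'a and X assume X: "X \<in> ?W"
    let ?D = "deriv_act (rot x y)"
    have Q: "X - P X \<in> ?W"
      using X P(2) I by (intro subspace_diff[OF subspace_MC_W]) auto
    \<comment> \<open>Since \<open>I\<close> is invariant under the skew operator \<open>?D\<close>,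
      so is its complement; hence \<open>P\<close> commutes with \<open>?D\<close>.\<close>
    have "?D (X - P X) \<in> J"
      unfolding J_def
    proof (intro CollectI conjI ballI)
      show "?D (X - P X) \<in> ?W"
        by (rule deriv_act_MC_W[OF skew_rot Q])
      fix Z assume Z: "Z \<in> I"
      then have "tensor_inner Z (?D (X - P X)) = - tensor_inner (?D Z) (X - P X)"
        using tensor_inner_deriv_act[OF skew_rot WT WT[OF Q], of Z x y] I by auto
      also have "\<dots> = 0"
        using perp[OF DI[OF Z], of X] by (simp add: tensor_inner_commute[of _ "X - P X"])
      finally show "tensor_inner Z (?D (X - P X)) = 0" .
    qed
    then have "P (?D X - ?D (P X)) = 0"
      using PJ by (simp add: deriv_act_linear_simps)
    then show "P (?D X) = ?D (P X)"
      using P(3)[OF DI[OF P(2)[of X]]] by (simp add: linear_diff[OF P(1)])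
  qed (use dim in simp)
  then obtain s where s: "\<And>X. X \<in> ?W \<Longrightarrow> P X = s *\<^sub>R X"
    by blast
  show "I = {0} \<or> I = ?W"
  proof (cases "s = 0")
    case True
    then have "X = 0" if "X \<in> I" for X
      using P(3)[OF that] s[of X] that I by auto
    then show ?thesis
      using subspace_0[OF I(1)] by blast
  next
    case False
    have "X \<in> I" if "X \<in> ?W" for X
    proof -
      have "(1 / s) *\<^sub>R P X \<in> I"
        by (intro subspace_scale I P)
      then show ?thesis
        using s[OF that] False by simp
    qed
    then show ?thesis
      using I by blast
  qed
qed

theorem theorem1p3:
  assumes "DIM('a::euclidean_space) \<ge> 4"
  shows "comm_algebra (MC_W :: ('a list \<Rightarrow> real) set) curv_mult \<and>
    exact_algebra (MC_W :: ('a list \<Rightarrow> real) set) curv_mult \<and>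
    killing_metrized (MC_W :: ('a list \<Rightarrow> real) set) curv_mult \<and>
    (\<exists>c. c \<noteq> 0 \<and> (\<forall>X\<in>(MC_W :: ('a list \<Rightarrow> real) set). \<forall>Y\<in>MC_W.
      killing_form MC_W curv_mult X Y = c * tensor_inner X Y)) \<and>
    (DIM('a) > 4 \<longrightarrow> simple_algebra (MC_W :: ('a list \<Rightarrow> real) set) curv_mult)"
proof -
  let ?W = "MC_W :: ('a list \<Rightarrow> real) set"
  have WT: "?W \<subseteq> tensors 4"
    using MC_W_MC MC_tensors by blast
  obtain E where E: "orthonormal_basis tensor_inner ?W E"
    using orthonormal_basis_exists[OF subspace_MC_W WT] .
  obtain c where c: "c \<noteq> 0" "\<And>X Y. X \<in> ?W \<Longrightarrow> Y \<in> ?W \<Longrightarrow> ktrace E X Y = c * tensor_inner X Y"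
    using ktrace_scalar[OF E assms] by blast
  have k: "killing_form ?W curv_mult X Y = c * tensor_inner X Y" if "X \<in> ?W" "Y \<in> ?W" for X Y
    using that by (simp add: killing_form_eq_ktrace[OF E] c)
  have "\<exists>B. finite B \<and> span B = ?W"
    by (rule subspace_finite_span[OF subspace_MC_W WT]) auto
  then have "comm_algebra ?W curv_mult"
    unfolding comm_algebra_def
    by (intro conjI ballI allI)
      (auto simp: subspace_MC_W linear_add[OF linear_curv_mult] linear_scale[OF linear_curv_mult]
        intro: curv_mult_MC_W curv_mult_commute MC_W_MC)
  moreover have "exact_algebra ?W curv_mult"
    unfolding exact_algebra_def
    by (auto simp: trace_MC_W[OF E] linear_curv_mult curv_mult_MC_W exact_MC_W[OF E assms])
  moreover have "killing_metrized ?W curv_mult"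
    unfolding killing_metrized_def
  proof (intro conjI ballI impI)
    fix X assume X: "X \<in> ?W" and "\<forall>Y\<in>?W. killing_form ?W curv_mult X Y = 0"
    then have "tensor_inner X X = 0"
      using k[OF X X] c(1) by simp
    then show "X = 0"
      using tensor_inner_pos[of X] X WT by force
  next
    fix X Y Z assume W: "X \<in> ?W" "Y \<in> ?W" "Z \<in> ?W"
    \<comment> \<open>Commuting the first product lets the self-adjoint operator of \<open>Y\<close>
      pass to the other side.\<close>
    have "tensor_inner (curv_mult X Y) Z = tensor_inner X (curv_mult Y Z)"
      unfolding curv_mult_commute[OF MC_W_MC[OF W(1)] MC_W_MC[OF W(2)]]
      by (rule curv_mult_self_adjoint[OF MC_W_MC[OF W(2)]])
    then show "killing_form ?W curv_mult (curv_mult X Y) Z = killing_form ?W curv_mult X (curv_mult Y Z)"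
      by (simp add: k W curv_mult_MC_W)
  qed
  ultimately show ?thesis
    using k c(1) simple_MC_W by blast
qed

end
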